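(* Let $X\sim p_0=\mathcal N(\mu_0,\sigma_0^2)$ with $\sigma_0^2>0$, let $\pi(x,y,z)=\frac{1}{\sigma_0^2}[(z-x)^2-(y-x)^2]$, and for $R,R_s\ge 0$ let $\mathcal P(R,R_s)$ be the set of conditional distributions $p(y,u|x)$ satisfying $R_s\ge I(X;Y|U)$ and $R\ge I(X;U,Y)$. A jointly Gaussian choice of the variables is in general not optimal for the problem of maximizing $\min_{z(\cdot)}\mathbb E\,\pi(X,Y,z(U))$ over $\mathcal P(R,R_s)$: there exist rates $R,R_s\ge0$ such that $$\sup_{\substack{p(y,u|x)\in\mathcal P(R,R_s)\\ (X,Y,U)\text{ jointly Gaussian}}}\ \min_{z(\cdot)}\ \mathbb E\,\pi(X,Y,z(U))\ <\ \sup_{p(y,u|x)\in\mathcal P(R,R_s)}\ \min_{z(\cdot)}\ \mathbb E\,\pi(X,Y,z(U)).$$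
   Context: $Y$ is real-valued and $U$ is an auxiliary random variable (real-valued in the jointly Gaussian case), both generated from $X$ by $p(y,u|x)$; the inner minimum is over functions $z$ of $u$. *)

theory Defs
  imports "HOL-Probability.Probability"
begin

text \<open>
  The library's \<open>KL_divergence b M N\<close> is the Bochner integral of
  \<open>log b (dN/dM)\<close> with respect to \<open>N\<close>. It is real-valued, and meaningless when
  \<open>N\<close> is not absolutely continuous with respect to \<open>M\<close> or when the integral diverges.
  For probability measures the negative part of the integrand is always integrable, so the
  divergence \<open>D(N || M)\<close> is infinite in exactly these two cases. Logarithms are to
  base 2, so rates are in bits.
\<close>

definition KL_ext :: "'a measure \<Rightarrow> 'a measure \<Rightarrow> ereal" where
  "KL_ext M N =
    (if absolutely_continuous M N \<and> integrable N (entropy_density 2 M N)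
     then ereal (KL_divergence 2 M N) else \<infinity>)"

text \<open>\<open>I(X;Y)\<close> for \<open>X\<close> valued in \<open>S\<close> and \<open>Y\<close> valued in \<open>T\<close>,
  on the probability space \<open>P\<close>.\<close>

definition mutual_info ::
    "'w measure \<Rightarrow> 'a measure \<Rightarrow> 'b measure \<Rightarrow> ('w \<Rightarrow> 'a) \<Rightarrow> ('w \<Rightarrow> 'b) \<Rightarrow> ereal" where
  "mutual_info P S T X Y =
    KL_ext (distr P S X \<Otimes>\<^sub>M distr P T Y) (distr P (S \<Otimes>\<^sub>M T) (\<lambda>w. (X w, Y w)))"

text \<open>\<open>W\<close> is a regular conditional distribution of \<open>X\<close> given \<open>U\<close>.\<close>

definition is_cond_distr ::
    "'w measure \<Rightarrow> 'a measure \<Rightarrow> 'c measure \<Rightarrow> ('w \<Rightarrow> 'a) \<Rightarrow> ('w \<Rightarrow> 'c) \<Rightarrow> ('c \<Rightarrow> 'a measure) \<Rightarrow> bool" where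
  "is_cond_distr P S T X U W \<longleftrightarrow>
    W \<in> T \<rightarrow>\<^sub>M prob_algebra S \<and>
    distr P (S \<Otimes>\<^sub>M T) (\<lambda>w. (X w, U w)) =
      distr P T U \<bind> (\<lambda>u. distr (W u) (S \<Otimes>\<^sub>M T) (\<lambda>x. (x, u)))"

text \<open>
  Below, \<open>X\<close> is real-valued, so a regular conditional distribution exists, and it is
  unique up to null sets of the law of \<open>U\<close>. Hence \<open>cond_indep_law\<close>, in which it is
  integrated against that law, does not depend on the choice made here.
\<close>

definition cond_distr ::
    "'w measure \<Rightarrow> 'a measure \<Rightarrow> 'c measure \<Rightarrow> ('w \<Rightarrow> 'a) \<Rightarrow> ('w \<Rightarrow> 'c) \<Rightarrow> 'c \<Rightarrow> 'a measure" where
  "cond_distr P S T X U = (SOME W. is_cond_distr P S T X U W)"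

text \<open>The law \<open>P\<^sub>U P\<^sub>X\<^sub>|\<^sub>U P\<^sub>Y\<^sub>|\<^sub>U\<close>, under which \<open>X\<close> and \<open>Y\<close> are
  conditionally independent given \<open>U\<close>.\<close>

definition cond_indep_law ::
    "'w measure \<Rightarrow> ('w \<Rightarrow> real) \<Rightarrow> ('w \<Rightarrow> real) \<Rightarrow> ('w \<Rightarrow> real) \<Rightarrow> (real \<times> real \<times> real) measure" where
  "cond_indep_law P X Y U =
    distr P borel U \<bind> (\<lambda>u.
      distr (cond_distr P borel borel X U u \<Otimes>\<^sub>M cond_distr P borel borel Y U u)
        (borel \<Otimes>\<^sub>M borel \<Otimes>\<^sub>M borel) (\<lambda>(x, y). (x, y, u)))"

text \<open>\<open>I(X;Y|U) = D(P\<^sub>X\<^sub>Y\<^sub>U || P\<^sub>U P\<^sub>X\<^sub>|\<^sub>U P\<^sub>Y\<^sub>|\<^sub>U)\<close>. The library's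
  \<open>conditional_mutual_information\<close> is the difference \<open>I(X;Y,U) - I(X;U)\<close>
  of real-valued quantities, which is wrong when these are infinite.\<close>

definition cond_mutual_info ::
    "'w measure \<Rightarrow> ('w \<Rightarrow> real) \<Rightarrow> ('w \<Rightarrow> real) \<Rightarrow> ('w \<Rightarrow> real) \<Rightarrow> ereal" where
  "cond_mutual_info P X Y U =
    KL_ext (cond_indep_law P X Y U)
      (distr P (borel \<Otimes>\<^sub>M borel \<Otimes>\<^sub>M borel) (\<lambda>w. (X w, Y w, U w)))"

text \<open>
  Conditional distributions \<open>p(y,u|x)\<close> are Markov kernels from the reals to pairs
  \<open>(y, u)\<close> of reals. Up to Borel isomorphism, real-valued \<open>U\<close> covers every standard
  Borel alphabet.
\<close>

type_synonym channel = "real \<Rightarrow> (real \<times> real) measure"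

definition channels :: "channel set" where
  "channels = borel \<rightarrow>\<^sub>M prob_algebra (borel \<Otimes>\<^sub>M borel)"

definition source :: "real \<Rightarrow> real \<Rightarrow> real measure" where
  "source \<mu> \<sigma> = density lborel (\<lambda>x. ennreal (normal_density \<mu> \<sigma> x))"

definition joint_law :: "real \<Rightarrow> real \<Rightarrow> channel \<Rightarrow> (real \<times> real \<times> real) measure" where
  "joint_law \<mu> \<sigma> \<kappa> =
    source \<mu> \<sigma> \<bind> (\<lambda>x. distr (\<kappa> x) (borel \<Otimes>\<^sub>M borel \<Otimes>\<^sub>M borel) (\<lambda>(y, u). (x, y, u)))"

abbreviation Xv :: "real \<times> real \<times> real \<Rightarrow> real" where "Xv \<equiv> \<lambda>(x, y, u). x"
abbreviation Yv :: "real \<times> real \<times> real \<Rightarrow> real" where "Yv \<equiv> \<lambda>(x, y, u). y"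
abbreviation Uv :: "real \<times> real \<times> real \<Rightarrow> real" where "Uv \<equiv> \<lambda>(x, y, u). u"

definition feasible :: "real \<Rightarrow> real \<Rightarrow> real \<Rightarrow> real \<Rightarrow> channel set" where
  "feasible \<mu> \<sigma> R Rs = {\<kappa> \<in> channels.
     ereal Rs \<ge> cond_mutual_info (joint_law \<mu> \<sigma> \<kappa>) Xv Yv Uv \<and>
     ereal R \<ge> mutual_info (joint_law \<mu> \<sigma> \<kappa>) borel (borel \<Otimes>\<^sub>M borel) Xv (\<lambda>w. (Uv w, Yv w))}"

text \<open>Gaussian laws on the line include the degenerate ones (point masses), so that joint
  Gaussianity is the usual condition on all linear combinations; singular covariance matrices,
  e.g. constant \<open>U\<close>, are allowed.\<close>

definition gaussian_law :: "real measure \<Rightarrow> bool" where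
  "gaussian_law N \<longleftrightarrow>
    (\<exists>m. N = return borel m) \<or>
    (\<exists>m s. s > 0 \<and> N = density lborel (\<lambda>x. ennreal (normal_density m s x)))"

definition jointly_gaussian :: "(real \<times> real \<times> real) measure \<Rightarrow> bool" where
  "jointly_gaussian P \<longleftrightarrow>
    (\<forall>a b c. gaussian_law (distr P borel (\<lambda>(x, y, u). a * x + b * y + c * u)))"

definition payoff :: "real \<Rightarrow> real \<Rightarrow> real \<Rightarrow> real \<Rightarrow> real" where
  "payoff \<sigma> x y z = 1 / \<sigma>\<^sup>2 * ((z - x)\<^sup>2 - (y - x)\<^sup>2)"

definition ext_expectation :: "'w measure \<Rightarrow> ('w \<Rightarrow> real) \<Rightarrow> ereal" where
  "ext_expectation P f =
    enn2ereal (\<integral>\<^sup>+ w. ennreal (f w) \<partial>P) - enn2ereal (\<integral>\<^sup>+ w. ennreal (- f w) \<partial>P)"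

text \<open>
  The minimum over measurable \<open>z\<close> is written as an infimum; it is attained. If
  \<open>Y\<close> is square-integrable, the negative part of the payoff is integrable for every
  \<open>z\<close> and the minimizer is the conditional mean of \<open>X\<close> given \<open>U\<close>.
  Otherwise the value is \<open>-\<infinity>\<close>, attained at \<open>z = 0\<close>. The convention
  \<open>\<infinity> - \<infinity> = \<infinity>\<close> for \<open>ereal\<close> thus never affects the infimum.
\<close>

definition min_payoff :: "real \<Rightarrow> real \<Rightarrow> channel \<Rightarrow> ereal" where
  "min_payoff \<mu> \<sigma> \<kappa> =
    (INF z \<in> borel_measurable borel.
       ext_expectation (joint_law \<mu> \<sigma> \<kappa>) (\<lambda>(x, y, u). payoff \<sigma> x y (z u)))"

end

theory Submission
  imports Defs
begin

text \<open>
  Take \<open>R\<^sub>s = 1\<close> bit. If \<open>(X, Y, U)\<close> is jointly Gaussian, then \<open>X\<close> given \<open>U = u\<close> is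
  normal with a mean \<open>m u\<close> and a variance \<open>v \<le> \<sigma>\<^sup>2\<close> that does not depend on \<open>u\<close>, and
  the Shannon lower bound \<open>I(X;Y|U) \<ge> 1/2 log (v / E (X - Y)\<^sup>2)\<close> forces
  \<open>E (X - Y)\<^sup>2 \<ge> v / 4\<close>. Playing \<open>z = m\<close> keeps the payoff below
  \<open>(v - v / 4) / \<sigma>\<^sup>2 \<le> 3 / 4\<close>, whatever \<open>R\<close> is.

  A non-Gaussian channel does better by spending the one secret bit on the sign: let \<open>U\<close> be a
  finite quantization of \<open>|X - \<mu>|\<close> and \<open>Y = \<mu> + sgn (X - \<mu>) U\<close>. Given \<open>U\<close>, the value of
  \<open>Y\<close> is at most one fair bit, so \<open>I(X;Y|U) \<le> 1\<close>; by symmetry \<open>E (X | U) = \<mu>\<close>, so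
  \<open>U\<close> does not help in estimating \<open>X\<close>; and \<open>E (X - Y)\<^sup>2 \<le> \<sigma>\<^sup>2 / 8\<close> once the quantizer is
  fine enough. The payoff is then at least \<open>7 / 8\<close>, and \<open>R\<close> only has to exceed the finite
  number \<open>I(X;U,Y)\<close>.
\<close>

section \<open>Bounds on relative entropy\<close>

text \<open>Where the gap comes from: for Gaussian pairs every dependence of \<open>U\<close> on
  \<open>X\<close> is visible in the conditional mean, so whatever \<open>U\<close> reveals also
  helps the opponent \<open>z\<close>. The magnitude of \<open>X - \<mu>\<close> is dependent on
  \<open>X\<close> yet uncorrelated with it: it is charged to \<open>R\<close> only and leaves the
  opponent at the full variance. The factor 4 is \<open>2^2\<close>, the variance reduction that one
  bit buys. Any quantizer with error below a quarter of the variance would separate the two sides;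
  1/8 leaves room for crude estimates. No information quantity is computed. Upper bounds come from
  setwise domination of the joint law by \<open>K\<close> times the reference law, the lower bound
  from a single test function. Two obstacles shape the rest. \<open>cond_distr\<close> is a choice,
  so almost sure uniqueness of conditional laws has to precede every estimate of I(X;Y|U). Singular
  covariances are allowed, so there may be no joint density, and independence of the regression
  residual is proved with characteristic functions.\<close>

lemma RN_deriv_le_const:
  fixes K :: real
  assumes Q: "prob_space Q" and P: "prob_space P" and sets: "sets P = sets Q"
    and dom: "\<And>C. C \<in> sets Q \<Longrightarrow> emeasure P C \<le> ennreal K * emeasure Q C"
  shows "absolutely_continuous Q P" "AE x in Q. RN_deriv Q P x \<le> ennreal K"
proof -
  interpret Q: prob_space Q by fact
  interpret P: prob_space P by fact
  show ac: "absolutely_continuous Q P"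
    unfolding absolutely_continuous_def
  proof
    fix C assume "C \<in> null_sets Q"
    then show "C \<in> null_sets P" using dom[of C] sets by (simp add: null_sets_def)
  qed
  define r where "r = RN_deriv Q P"
  have r[measurable]: "r \<in> borel_measurable Q" unfolding r_def by simp
  have Pr: "density Q r = P" unfolding r_def using ac sets by (rule Q.density_RN_deriv)
  \<comment> \<open>On \<open>A\<close> the difference of \<open>r\<close> and \<open>K\<close> is
    positive, yet its integral is \<open>P A - K * Q A\<close>, which domination makes zero in the
    truncated subtraction of \<open>ennreal\<close>. So \<open>A\<close> is null.\<close>
  define A where "A = {x \<in> space Q. r x > ennreal K}"
  have A[measurable]: "A \<in> sets Q" unfolding A_def by measurable
  have 1: "(\<integral>\<^sup>+x. r x * indicator A x \<partial>Q) = emeasure P A"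
    using A by (subst Pr[symmetric]) (simp add: emeasure_density)
  have 2: "(\<integral>\<^sup>+x. ennreal K * indicator A x \<partial>Q) = ennreal K * emeasure Q A"
    by (simp add: nn_integral_cmult_indicator)
  have 3: "(\<integral>\<^sup>+x. ennreal K * indicator A x \<partial>Q) \<noteq> \<infinity>"
    by (simp add: 2 ennreal_mult_eq_top_iff Q.emeasure_eq_measure)
  have "(\<integral>\<^sup>+x. (r x * indicator A x - ennreal K * indicator A x) \<partial>Q)
      = (\<integral>\<^sup>+x. r x * indicator A x \<partial>Q) - (\<integral>\<^sup>+x. ennreal K * indicator A x \<partial>Q)"
    by (rule nn_integral_diff)
       (use 3 in \<open>auto simp: A_def less_imp_le split: split_indicator\<close>)
  also have "\<dots> = 0"
    unfolding 1 2 using dom[OF A]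
    by (simp add: diff_eq_0_iff_ennreal P.emeasure_eq_measure ennreal_less_top)
  finally have "AE x in Q. r x * indicator A x - ennreal K * indicator A x = 0"
    by (subst (asm) nn_integral_0_iff_AE) auto
  then show "AE x in Q. RN_deriv Q P x \<le> ennreal K"
    using AE_space unfolding r_def[symmetric]
  proof eventually_elim
    case (elim x)
    show ?case
    proof (rule ccontr)
      assume "\<not> r x \<le> ennreal K"
      then have "x \<in> A" using elim by (auto simp: A_def)
      with elim have "r x - ennreal K = 0" by simp
      then have "r x \<le> ennreal K" by (simp add: diff_eq_0_iff_ennreal)
      with \<open>\<not> r x \<le> ennreal K\<close> show False by simp
    qed
  qed
qed

text \<open>Serves to make \<open>r * log 2 r\<close> integrable for a bounded density
  \<open>r\<close>: the bound covers small \<open>r\<close>, where the logarithm is unbounded,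
  together with large \<open>r\<close>.\<close>

lemma abs_mult_ln_le:
  fixes r :: real
  assumes "0 \<le> r"
  shows "\<bar>r * ln r\<bar> \<le> r\<^sup>2 + 1"
proof (cases "r = 0")
  case False
  with assms have r: "r > 0" by simp
  have "ln r \<le> r" using ln_le_minus_one[OF r] by simp
  then have 1: "r * ln r \<le> r\<^sup>2" using r by (simp add: power2_eq_square)
  have "- ln r \<le> 1 / r - 1" using ln_le_minus_one[of "1 / r"] r by (simp add: ln_div)
  then have "r * (- ln r) \<le> r * (1 / r - 1)" using r by (intro mult_left_mono) auto
  then have "- (r * ln r) \<le> 1 - r" using r by (simp add: algebra_simps)
  then show ?thesis using 1 r by (simp only: abs_le_iff) (smt (verit) zero_le_power2)
qed simp

text \<open>Setwise domination bounds the density by \<open>K\<close> almost everywhere, and the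
  divergence is the \<open>P\<close>-mean of the logarithm of that density. Every upper bound on an
  information quantity below is obtained in this way.\<close>

lemma KL_ext_le:
  fixes K :: real
  assumes Q: "prob_space Q" and P: "prob_space P" and sets: "sets P = sets Q"
    and dom: "\<And>C. C \<in> sets Q \<Longrightarrow> emeasure P C \<le> ennreal K * emeasure Q C"
  shows "KL_ext Q P \<le> ereal (log 2 K)"
proof -
  interpret Q: prob_space Q by fact
  interpret P: prob_space P by fact
  have ac: "absolutely_continuous Q P"
    by (rule RN_deriv_le_const(1)[OF Q P sets dom])
  define r where "r x = enn2real (RN_deriv Q P x)" for x
  have r[measurable]: "r \<in> borel_measurable Q" unfolding r_def by simp
  have r0: "r x \<ge> 0" for x unfolding r_def by simp
  have K0: "K > 0"
  proof (rule ccontr)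
    assume "\<not> K > 0"
    then have "ennreal K = 0" by (simp add: ennreal_neg)
    with dom[of "space Q"] P.emeasure_space_1 sets_eq_imp_space_eq[OF sets] show False by simp
  qed
  have rK: "AE x in Q. r x \<le> K \<and> RN_deriv Q P x = ennreal (r x)"
    using RN_deriv_le_const(2)[OF Q P sets dom, simplified]
  proof eventually_elim
    case (elim x)
    then have "RN_deriv Q P x < \<top>" using ennreal_less_top le_less_trans by blast
    then show ?case using elim K0 unfolding r_def
      by (metis enn2real_leI ennreal_enn2real less_imp_le)
  qed
  have Pr: "P = density Q r"
  proof -
    have "P = density Q (RN_deriv Q P)" using ac sets by (simp add: Q.density_RN_deriv)
    also have "\<dots> = density Q r" using rK by (intro density_cong) auto
    finally show ?thesis .
  qed
  have ed: "entropy_density 2 Q P x = log 2 (r x)" for x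
    by (simp add: entropy_density_def r_def)
  have int: "integrable P (entropy_density 2 Q P)"
  proof -
    have "integrable Q (\<lambda>x. r x * log 2 (r x))"
    proof (rule Q.integrable_const_bound[where B="(K\<^sup>2 + 1) / ln 2"])
      show "AE x in Q. norm (r x * log 2 (r x)) \<le> (K\<^sup>2 + 1) / ln 2"
        using rK
      proof eventually_elim
        case (elim x)
        have "(r x)\<^sup>2 \<le> K\<^sup>2" using elim r0 by (intro power_mono) auto
        then have "\<bar>r x * ln (r x)\<bar> \<le> K\<^sup>2 + 1" using abs_mult_ln_le[OF r0[of x]] by linarith
        then have "\<bar>r x * ln (r x)\<bar> / ln 2 \<le> (K\<^sup>2 + 1) / ln 2" by (intro divide_right_mono) auto
        then show ?case by (simp add: log_def abs_mult)
      qed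
    qed measurable
    then show ?thesis
      unfolding ed[abs_def] using r0 by (subst Pr, subst integrable_density) auto
  qed
  have "AE x in P. entropy_density 2 Q P x \<le> log 2 K"
    unfolding ed by (subst Pr, subst AE_density) (use rK in \<open>auto elim!: eventually_mono\<close>)
  then have "integral\<^sup>L P (entropy_density 2 Q P) \<le> (\<integral>x. log 2 K \<partial>P)"
    by (intro integral_mono_AE int) auto
  then have "KL_divergence 2 Q P \<le> log 2 K"
    unfolding KL_divergence_def using P.prob_space by simp
  then show ?thesis using ac int by (simp add: KL_ext_def)
qed

text \<open>The easy half of the Donsker-Varadhan formula, with test function \<open>log g\<close>.\<close>

lemma integral_log_le_of_KL_ext_le:
  assumes Q: "prob_space Q" and P: "prob_space P" and sets: "sets P = sets Q"
    and g[measurable]: "g \<in> borel_measurable Q" and pos: "\<And>x. g x > 0"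
    and le1: "(\<integral>\<^sup>+x. ennreal (g x) \<partial>Q) \<le> 1"
    and int: "integrable P (\<lambda>x. log 2 (g x))"
    and KL: "KL_ext Q P \<le> ereal c"
  shows "(\<integral>x. log 2 (g x) \<partial>P) \<le> c"
proof -
  interpret Q: prob_space Q by fact
  interpret P: prob_space P by fact
  have ac: "absolutely_continuous Q P" and ied: "integrable P (entropy_density 2 Q P)"
    and kl: "integral\<^sup>L P (entropy_density 2 Q P) \<le> c"
    using KL unfolding KL_ext_def KL_divergence_def by (auto split: if_splits)
  define r where "r x = enn2real (RN_deriv Q P x)" for x
  have r[measurable]: "r \<in> borel_measurable Q" unfolding r_def by simp
  have r0: "r x \<ge> 0" for x unfolding r_def by simp
  have Pr: "P = density Q r"
  proof -
    have "P = density Q (RN_deriv Q P)" using ac sets by (simp add: Q.density_RN_deriv)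
    also have "\<dots> = density Q r"
      using Q.RN_deriv_finite[OF P.sigma_finite_measure_axioms ac sets]
      by (intro density_cong) (auto simp: r_def ennreal_enn2real_if)
    finally show ?thesis .
  qed
  have ed: "entropy_density 2 Q P x = log 2 (r x)" for x
    by (simp add: entropy_density_def r_def)
  have gP[measurable]: "g \<in> borel_measurable P" "r \<in> borel_measurable P"
    using sets by (simp_all cong: measurable_cong_sets)
  have rpos: "AE x in P. r x > 0"
    by (subst Pr, subst AE_density) auto
  have "(\<integral>\<^sup>+x. ennreal (g x / r x) \<partial>P) = (\<integral>\<^sup>+x. ennreal (r x) * ennreal (g x / r x) \<partial>Q)"
    by (subst Pr, subst nn_integral_density) auto
  \<comment> \<open>Equality can fail only where \<open>r\<close> vanishes: there
    \<open>r * (g / r)\<close> is zero while \<open>g\<close> is positive.\<close>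
  also have "\<dots> \<le> (\<integral>\<^sup>+x. ennreal (g x) \<partial>Q)"
    using r0 pos by (intro nn_integral_mono) (auto simp: ennreal_mult[symmetric] less_imp_le)
  finally have nn: "(\<integral>\<^sup>+x. ennreal (g x / r x) \<partial>P) \<le> 1" using le1 by simp
  have gr0: "g x / r x \<ge> 0" for x using pos[of x] r0[of x] by simp
  have igr: "integrable P (\<lambda>x. g x / r x)"
    using nn gr0 by (intro integrableI_nonneg) (auto intro: le_less_trans)
  have gr1: "(\<integral>x. g x / r x \<partial>P) \<le> 1"
    using nn gr0 igr by (subst (asm) nn_integral_eq_integral) auto
  \<comment> \<open>The tangent bound \<open>ln t \<le> t - 1\<close> at \<open>t = g / r\<close>,
    integrated under \<open>P\<close>, plays the part of Jensen's inequality.\<close>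
  have "0 \<le> (\<integral>x. (1 - g x / r x) / ln 2 \<partial>P)"
    using gr1 igr P.prob_space by simp
  also have "\<dots> \<le> (\<integral>x. entropy_density 2 Q P x - log 2 (g x) \<partial>P)"
  proof (rule integral_mono_AE)
    show "AE x in P. (1 - g x / r x) / ln 2 \<le> entropy_density 2 Q P x - log 2 (g x)"
      using rpos
    proof eventually_elim
      case (elim x)
      have "ln (g x / r x) \<le> g x / r x - 1"
        using elim pos[of x] by (intro ln_le_minus_one) auto
      then have "1 - g x / r x \<le> ln (r x) - ln (g x)"
        using elim pos[of x] by (simp add: ln_div)
      then show ?case unfolding ed log_def
        by (simp add: diff_divide_distrib[symmetric] divide_right_mono)
    qed
  qed (use igr ied int in auto)
  also have "\<dots> = integral\<^sup>L P (entropy_density 2 Q P) - (\<integral>x. log 2 (g x) \<partial>P)"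
    using ied int by simp
  finally show ?thesis using kl by simp
qed

section \<open>Conditional distributions\<close>

text \<open>Right continuity of the distribution functions lets rational half-lines suffice. Their
  countability is the point: identities that each hold almost surely can then be merged into one
  null set.\<close>

lemma real_measure_eqI_rat:
  fixes M N :: "real measure"
  assumes M: "real_distribution M" and N: "real_distribution N"
    and eq: "\<And>q. q \<in> \<rat> \<Longrightarrow> emeasure M {..q} = emeasure N {..q}"
  shows "M = N"
proof (rule cdf_unique[OF M N], rule ext)
  interpret M: real_distribution M by fact
  interpret N: real_distribution N by fact
  fix x :: real
  have "\<exists>q\<in>\<rat>. x < q \<and> q < x + inverse (real (Suc n))" for n
    by (rule Rats_dense_in_real) simp
  then obtain q where q: "\<And>n. q n \<in> \<rat>" "\<And>n. x < q n" "\<And>n. q n < x + inverse (real (Suc n))"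
    by metis
  have "q \<longlonglongrightarrow> x"
  proof (rule real_tendsto_sandwich[where f="\<lambda>_. x" and h="\<lambda>n. x + inverse (real (Suc n))"])
    show "(\<lambda>n. x + inverse (real (Suc n))) \<longlonglongrightarrow> x"
      by (rule LIMSEQ_inverse_real_of_nat_add)
  qed (use q(2,3) in \<open>auto intro!: always_eventually less_imp_le simp del: of_nat_Suc\<close>)
  then have lim: "filterlim q (at_right x) sequentially"
    using q(2) by (auto simp: filterlim_at intro!: always_eventually)
  have "(\<lambda>n. cdf M (q n)) \<longlonglongrightarrow> cdf M x" "(\<lambda>n. cdf N (q n)) \<longlonglongrightarrow> cdf N x"
    using M.cdf_is_right_cont[of x] N.cdf_is_right_cont[of x] lim
    unfolding continuous_within by (auto intro: filterlim_compose)
  moreover have "cdf M (q n) = cdf N (q n)" for n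
    using eq[OF q(1)] by (simp add: cdf_def measure_def)
  ultimately show "cdf M x = cdf N x" by (simp add: LIMSEQ_unique)
qed

text \<open>For fixed \<open>q\<close>, the function mapping \<open>u\<close> to the mass that
  \<open>W u\<close> gives to \<open>{..q}\<close> is a density, with respect to the law of
  \<open>U\<close>, of the measure sending \<open>B\<close> to the probability of
  \<open>X \<le> q\<close> and \<open>U \<in> B\<close>. Densities are almost surely unique, and
  countably many rational \<open>q\<close> determine the whole law.\<close>

lemma is_cond_distr_unique:
  fixes X :: "'w \<Rightarrow> real"
  assumes P: "prob_space P" and X[measurable]: "X \<in> borel_measurable P" and U[measurable]: "U \<in> P \<rightarrow>\<^sub>M T"
    and W: "is_cond_distr P borel T X U W" and W': "is_cond_distr P borel T X U W'"
  shows "AE u in distr P T U. W u = W' u"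
proof -
  interpret P: prob_space P by fact
  let ?L = "distr P T U"
  interpret L: prob_space ?L by (rule P.prob_space_distr) measurable
  have rect: "(\<integral>\<^sup>+u. emeasure (V u) {..q} * indicator B u \<partial>?L)
      = emeasure (distr P (borel \<Otimes>\<^sub>M T) (\<lambda>w. (X w, U w))) ({..q} \<times> B)"
    if V: "is_cond_distr P borel T X U V" and B: "B \<in> sets T" for V B q
  proof -
    have Vm[measurable]: "V \<in> T \<rightarrow>\<^sub>M prob_algebra borel"
      and eq: "distr P (borel \<Otimes>\<^sub>M T) (\<lambda>w. (X w, U w)) =
        ?L \<bind> (\<lambda>u. distr (V u) (borel \<Otimes>\<^sub>M T) (\<lambda>x. (x, u)))"
      using V by (auto simp: is_cond_distr_def)
    have 0: "?L \<in> space (prob_algebra T)"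
      using L.prob_space_axioms by (simp add: space_prob_algebra)
    have "emeasure (distr P (borel \<Otimes>\<^sub>M T) (\<lambda>w. (X w, U w))) ({..q} \<times> B)
      = (\<integral>\<^sup>+u. emeasure (distr (V u) (borel \<Otimes>\<^sub>M T) (\<lambda>x. (x, u))) ({..q} \<times> B) \<partial>?L)"
      unfolding eq using B by (intro emeasure_bind_prob_algebra[OF 0, where L="borel \<Otimes>\<^sub>M T"]) auto
    also have "\<dots> = (\<integral>\<^sup>+u. emeasure (V u) {..q} * indicator B u \<partial>?L)"
    proof (rule nn_integral_cong)
      fix u assume "u \<in> space ?L"
      then have u: "u \<in> space T" by simp
      then have sp: "sets (V u) = sets borel" "space (V u) = UNIV"
        using measurable_space[OF Vm u] by (auto simp: space_prob_algebra dest: sets_eq_imp_space_eq)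
      have [measurable]: "(\<lambda>x. (x, u)) \<in> V u \<rightarrow>\<^sub>M borel \<Otimes>\<^sub>M T"
        using u by (simp cong: measurable_cong_sets add: sp)
      have "(\<lambda>x. (x, u)) -` ({..q} \<times> B) \<inter> space (V u) = (if u \<in> B then {..q} else {})"
        by (auto simp: sp)
      then show "emeasure (distr (V u) (borel \<Otimes>\<^sub>M T) (\<lambda>x. (x, u))) ({..q} \<times> B)
          = emeasure (V u) {..q} * indicator B u"
        using B by (subst emeasure_distr) auto
    qed
    finally show ?thesis by simp
  qed
  have Wm[measurable]: "W \<in> T \<rightarrow>\<^sub>M prob_algebra borel" "W' \<in> T \<rightarrow>\<^sub>M prob_algebra borel"
    using W W' by (auto simp: is_cond_distr_def)
  have "AE u in ?L. \<forall>q\<in>\<rat>. emeasure (W u) {..q} = emeasure (W' u) {..q}"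
  proof (subst AE_ball_countable[OF countable_rat], rule ballI)
    fix q :: real
    have [measurable]: "(\<lambda>u. emeasure (V u) {..q}) \<in> borel_measurable T"
      if [measurable]: "V \<in> T \<rightarrow>\<^sub>M prob_algebra borel" for V
      using measurable_prob_algebraD[OF that]
      by (rule measurable_emeasure_kernel) simp
    show "AE u in ?L. emeasure (W u) {..q} = emeasure (W' u) {..q}"
      by (rule L.density_unique_finite_measure) (auto simp: rect[OF W] rect[OF W'])
  qed
  moreover have "AE u in ?L. u \<in> space T" using AE_space[of ?L] by simp
  ultimately show ?thesis
  proof eventually_elim
    case (elim u)
    have "real_distribution (V u)" if V: "V \<in> T \<rightarrow>\<^sub>M prob_algebra borel" for V
      using measurable_space[OF V elim(2)] unfolding space_prob_algebra
      by (intro real_distribution.intro real_distribution_axioms.intro) auto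
    then show ?case using elim Wm by (intro real_measure_eqI_rat) auto
  qed
qed

text \<open>Removes the choice hidden in \<open>cond_distr\<close>: the given versions show that the
  choice succeeds, and by uniqueness it differs from them on a null set only. Each half of the proof
  can then insert the explicit kernels suited to it, fiber laws for the quantizer and translated
  residual laws for the Gaussian case.\<close>

lemma cond_indep_law_eq:
  assumes P: "prob_space P" and [measurable]: "X \<in> borel_measurable P" "Y \<in> borel_measurable P" "U \<in> borel_measurable P"
    and W: "is_cond_distr P borel borel X U W" and V: "is_cond_distr P borel borel Y U V"
  shows "cond_indep_law P X Y U = distr P borel U \<bind> (\<lambda>u.
      distr (W u \<Otimes>\<^sub>M V u) (borel \<Otimes>\<^sub>M borel \<Otimes>\<^sub>M borel) (\<lambda>(x, y). (x, y, u)))"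
proof -
  interpret P: prob_space P by fact
  let ?W = "cond_distr P borel borel X U" and ?V = "cond_distr P borel borel Y U"
  have cW: "is_cond_distr P borel borel X U ?W"
    unfolding cond_distr_def using W by (rule someI[where P="is_cond_distr P borel borel X U"])
  have cV: "is_cond_distr P borel borel Y U ?V"
    unfolding cond_distr_def using V by (rule someI[where P="is_cond_distr P borel borel Y U"])
  have [measurable]: "W \<in> borel \<rightarrow>\<^sub>M prob_algebra borel" "V \<in> borel \<rightarrow>\<^sub>M prob_algebra borel"
     "?W \<in> borel \<rightarrow>\<^sub>M prob_algebra borel" "?V \<in> borel \<rightarrow>\<^sub>M prob_algebra borel"
    using W V cW cV by (auto simp: is_cond_distr_def)
  show ?thesis unfolding cond_indep_law_def
  proof (rule bind_cong_AE'[where L=borel and N="borel \<Otimes>\<^sub>M borel \<Otimes>\<^sub>M borel"])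
    show "distr P borel U \<in> space (prob_algebra borel)"
      by (simp add: space_prob_algebra P.prob_space_distr)
    show "AE u in distr P borel U.
      distr (?W u \<Otimes>\<^sub>M ?V u) (borel \<Otimes>\<^sub>M borel \<Otimes>\<^sub>M borel) (\<lambda>(x, y). (x, y, u)) =
      distr (W u \<Otimes>\<^sub>M V u) (borel \<Otimes>\<^sub>M borel \<Otimes>\<^sub>M borel) (\<lambda>(x, y). (x, y, u))"
      using is_cond_distr_unique[OF P assms(2,4) cW W] is_cond_distr_unique[OF P assms(3,4) cV V]
      by eventually_elim simp
  qed measurable
qed

section \<open>Finitely valued variables\<close>

text \<open>On each fiber the value of \<open>V\<close> is a constant, so an integrand depending on
  \<open>V\<close> turns into finitely many sections integrated over the fibers.\<close>

lemma nn_integral_finite_range: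
  assumes fin: "finite (V ` space M)"
    and V[measurable]: "\<And>v. V -` {v} \<inter> space M \<in> sets M"
    and f[measurable]: "\<And>v. v \<in> V ` space M \<Longrightarrow> (\<lambda>w. f w v) \<in> borel_measurable M"
  shows "(\<integral>\<^sup>+w. f w (V w) \<partial>M) =
    (\<Sum>v\<in>V ` space M. \<integral>\<^sup>+w. f w v * indicator (V -` {v} \<inter> space M) w \<partial>M)"
proof -
  have "(\<integral>\<^sup>+w. f w (V w) \<partial>M) =
      (\<integral>\<^sup>+w. (\<Sum>v\<in>V ` space M. f w v * indicator (V -` {v} \<inter> space M) w) \<partial>M)"
  proof (rule nn_integral_cong)
    fix w assume w: "w \<in> space M"
    have "(\<Sum>v\<in>V ` space M. f w v * indicator (V -` {v} \<inter> space M) w)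
        = (\<Sum>v\<in>V ` space M. if v = V w then f w v else 0)"
      using w by (intro sum.cong) (auto simp: indicator_def)
    also have "\<dots> = f w (V w)" using fin w by simp
    finally show "f w (V w) = (\<Sum>v\<in>V ` space M. f w v * indicator (V -` {v} \<inter> space M) w)" by simp
  qed
  also have "\<dots> = (\<Sum>v\<in>V ` space M. \<integral>\<^sup>+w. f w v * indicator (V -` {v} \<inter> space M) w \<partial>M)"
    by (rule nn_integral_sum) auto
  finally show ?thesis .
qed

text \<open>Every preimage is a subset of \<open>F\<close>, possibly enlarged by the complement of
  \<open>F\<close>. This makes \<open>fiber_law\<close> a kernel, since it is constant off the
  finite range of \<open>U\<close>.\<close>

lemma measurable_const_off_finite:
  fixes f :: "real \<Rightarrow> 'b"
  assumes "finite F" "\<And>u. u \<notin> F \<Longrightarrow> f u = c" "\<And>u. f u \<in> space N"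
  shows "f \<in> borel \<rightarrow>\<^sub>M N"
proof (rule measurableI)
  fix A assume "A \<in> sets N"
  have "f -` A \<inter> space borel = {u \<in> F. f u \<in> A} \<union> (if c \<in> A then - F else {})"
    using assms(2) by auto
  also have "\<dots> \<in> sets borel"
  proof (rule sets.Un)
    show "{u \<in> F. f u \<in> A} \<in> sets borel"
      using assms(1) by (intro borel_closed finite_imp_closed) auto
    show "(if c \<in> A then - F else {}) \<in> sets borel"
      using borel_comp[OF borel_closed[OF finite_imp_closed[OF assms(1)]]] by simp
  qed
  finally show "f -` A \<inter> space borel \<in> sets borel" .
qed (use assms in auto)

text \<open>On null fibers, where the conditional law is arbitrary, the unconditional one is used.\<close>

definition fiber_law :: "'w measure \<Rightarrow> 'a measure \<Rightarrow> ('w \<Rightarrow> 'a) \<Rightarrow> ('w \<Rightarrow> real) \<Rightarrow> real \<Rightarrow> 'a measure" where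
  "fiber_law M S X U u =
    distr (if emeasure M (U -` {u} \<inter> space M) = 0 then M
           else uniform_measure M (U -` {u} \<inter> space M)) S X"

lemma prob_space_fiber:
  assumes "prob_space M" "emeasure M (U -` {u} \<inter> space M) \<noteq> 0"
  shows "prob_space (uniform_measure M (U -` {u} \<inter> space M))"
proof -
  interpret prob_space M by fact
  show ?thesis using assms by (intro prob_space_uniform_measure) auto
qed

text \<open>On a fiber of positive mass this is elementary conditioning: the joint probability is
  the conditional one times the mass of the fiber. A null fiber contributes zero to both sides,
  whatever law is placed on it.\<close>

lemma is_cond_distr_fiber_law:
  assumes M: "prob_space M" and X[measurable]: "X \<in> M \<rightarrow>\<^sub>M S" and U[measurable]: "U \<in> borel_measurable M"
    and fin: "finite (U ` space M)"
  shows "is_cond_distr M S borel X U (fiber_law M S X U)"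
proof -
  interpret prob_space M by fact
  let ?W = "fiber_law M S X U" and ?E = "\<lambda>u. U -` {u} \<inter> space M"
  have W[measurable]: "?W \<in> borel \<rightarrow>\<^sub>M prob_algebra S"
  proof (rule measurable_const_off_finite[OF fin])
    fix u assume "u \<notin> U ` space M"
    \<comment> \<open>An empty fiber is null, so the default branch of \<open>fiber_law\<close>
      applies to all \<open>u\<close> outside the range, which gives the constant value.\<close>
    then have "?E u = {}" by auto
    then show "?W u = distr M S X" by (simp add: fiber_law_def)
  next
    fix u
    show "?W u \<in> space (prob_algebra S)"
      using prob_space_fiber[OF M, of U u]
      by (auto simp: fiber_law_def space_prob_algebra intro!: prob_space_distr prob_space.prob_space_distr)
  qed
  let ?N = "S \<Otimes>\<^sub>M (borel :: real measure)"
  have K[measurable]: "(\<lambda>u. distr (?W u) ?N (\<lambda>x. (x, u))) \<in> borel \<rightarrow>\<^sub>M prob_algebra ?N"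
    by measurable
  have L: "distr M borel U \<in> space (prob_algebra borel)"
    by (simp add: space_prob_algebra prob_space_distr)
  have "distr M ?N (\<lambda>w. (X w, U w)) = distr M borel U \<bind> (\<lambda>u. distr (?W u) ?N (\<lambda>x. (x, u)))"
  proof (rule measure_eqI)
    fix C assume "C \<in> sets (distr M ?N (\<lambda>w. (X w, U w)))"
    then have C[measurable]: "C \<in> sets ?N" by simp
    have [measurable]: "(\<lambda>x. (x, u)) \<in> S \<rightarrow>\<^sub>M ?N" for u by measurable
    have m[measurable]: "(\<lambda>w. indicator C (X w, u) :: ennreal) \<in> borel_measurable M" for u
      by measurable
    have Em[measurable]: "?E u \<in> sets M" for u by measurable
    have "emeasure (distr M ?N (\<lambda>w. (X w, U w))) C = (\<integral>\<^sup>+w. indicator C (X w, U w) \<partial>M)"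
      by (subst nn_integral_indicator[symmetric], simp, subst nn_integral_distr) auto
    also have "\<dots> = (\<Sum>u\<in>U ` space M. \<integral>\<^sup>+w. indicator C (X w, u) * indicator (?E u) w \<partial>M)"
      by (rule nn_integral_finite_range[OF fin]) auto
    also have "\<dots> = (\<Sum>u\<in>U ` space M. emeasure (distr (?W u) ?N (\<lambda>x. (x, u))) C * emeasure M (?E u))"
    proof (rule sum.cong[OF refl])
      fix u
      show "(\<integral>\<^sup>+w. indicator C (X w, u) * indicator (?E u) w \<partial>M) =
          emeasure (distr (?W u) ?N (\<lambda>x. (x, u))) C * emeasure M (?E u)"
      proof (cases "emeasure M (?E u) = 0")
        case True
        then have "AE w in M. w \<notin> ?E u" by (intro AE_not_in) auto
        then have "(\<integral>\<^sup>+w. indicator C (X w, u) * indicator (?E u) w \<partial>M) = (\<integral>\<^sup>+w. 0 \<partial>M)"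
          by (intro nn_integral_cong_AE) auto
        then show ?thesis using True by simp
      next
        case False
        let ?V = "uniform_measure M (?E u)"
        have "emeasure (distr (?W u) ?N (\<lambda>x. (x, u))) C = (\<integral>\<^sup>+w. indicator C (X w, u) \<partial>?V)"
          using False unfolding fiber_law_def
          by (subst nn_integral_indicator[symmetric], simp, subst nn_integral_distr, simp, simp,
              subst nn_integral_distr) auto
        also have "\<dots> = (\<integral>\<^sup>+w. indicator C (X w, u) * indicator (?E u) w \<partial>M) / emeasure M (?E u)"
          by (rule nn_integral_uniform_measure) auto
        finally show ?thesis using False
          by (simp add: ennreal_divide_times ennreal_divide_self emeasure_eq_measure)
      qed
    qed
    also have "\<dots> = (\<integral>\<^sup>+w. emeasure (distr (?W (U w)) ?N (\<lambda>x. (x, U w))) C \<partial>M)"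
      by (subst nn_integral_finite_range[OF fin, where f="\<lambda>w u. emeasure (distr (?W u) ?N (\<lambda>x. (x, u))) C"])
         (auto simp: nn_integral_cmult_indicator)
    also have "\<dots> = (\<integral>\<^sup>+u. emeasure (distr (?W u) ?N (\<lambda>x. (x, u))) C \<partial>distr M borel U)"
      by (subst nn_integral_distr) (auto intro!: measurable_emeasure_kernel measurable_prob_algebraD K)
    also have "\<dots> = emeasure (distr M borel U \<bind> (\<lambda>u. distr (?W u) ?N (\<lambda>x. (x, u)))) C"
      by (rule emeasure_bind_prob_algebra[OF L K C, symmetric])
    finally show "emeasure (distr M ?N (\<lambda>w. (X w, U w))) C =
        emeasure (distr M borel U \<bind> (\<lambda>u. distr (?W u) ?N (\<lambda>x. (x, u)))) C" .
  qed (simp add: sets_bind'[OF L K])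
  then show ?thesis using W by (simp add: is_cond_distr_def)
qed

text \<open>If the atom \<open>V = v\<close> has mass at least \<open>1 / K\<close>, then the
  probability that \<open>X\<close> lies in a set and \<open>V = v\<close> is at most the
  probability that \<open>X\<close> lies in it, hence at most \<open>K\<close> times the product of
  the two probabilities. Summing over \<open>v\<close> gives the domination that
  \<open>KL_ext_le\<close> asks for.\<close>

lemma distr_pair_le_product:
  assumes M: "prob_space M" and X[measurable]: "X \<in> M \<rightarrow>\<^sub>M S" and V[measurable]: "V \<in> M \<rightarrow>\<^sub>M T"
    and fin: "finite (V ` space M)" and Em[measurable]: "\<And>v. V -` {v} \<inter> space M \<in> sets M"
    and atoms: "AE w in M. 1 \<le> K * measure M (V -` {V w} \<inter> space M)"
    and C[measurable]: "C \<in> sets (S \<Otimes>\<^sub>M T)"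
  shows "emeasure (distr M (S \<Otimes>\<^sub>M T) (\<lambda>w. (X w, V w))) C
    \<le> ennreal K * emeasure (distr M S X \<Otimes>\<^sub>M distr M T V) C"
proof -
  interpret prob_space M by fact
  let ?E = "\<lambda>v. V -` {v} \<inter> space M"
  define a where "a v = (\<integral>\<^sup>+w. indicator C (X w, v) \<partial>M)" for v
  interpret X: prob_space "distr M S X" by (rule prob_space_distr) measurable
  interpret Y: prob_space "distr M T V" by (rule prob_space_distr) measurable
  interpret XY: pair_sigma_finite "distr M S X" "distr M T V" ..
  have ind: "(\<lambda>w. indicator C (X w, v) :: ennreal) \<in> borel_measurable M" if "v \<in> V ` space M" for v
  proof (rule measurable_compose[OF _ borel_measurable_indicator[OF C]])
    show "(\<lambda>w. (X w, v)) \<in> M \<rightarrow>\<^sub>M S \<Otimes>\<^sub>M T"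
      using that measurable_space[OF V] by (intro measurable_Pair X measurable_const) auto
  qed
  have "emeasure (distr M (S \<Otimes>\<^sub>M T) (\<lambda>w. (X w, V w))) C = (\<integral>\<^sup>+w. indicator C (X w, V w) \<partial>M)"
    by (subst nn_integral_indicator[symmetric], simp, subst nn_integral_distr) auto
  also have "\<dots> = (\<Sum>v\<in>V ` space M. \<integral>\<^sup>+w. indicator C (X w, v) * indicator (?E v) w \<partial>M)"
    by (rule nn_integral_finite_range[OF fin Em ind])
  also have "\<dots> \<le> (\<Sum>v\<in>V ` space M. ennreal K * (a v * emeasure M (?E v)))"
  proof (rule sum_mono)
    fix v assume v: "v \<in> V ` space M"
    show "(\<integral>\<^sup>+w. indicator C (X w, v) * indicator (?E v) w \<partial>M) \<le> ennreal K * (a v * emeasure M (?E v))"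
    proof (cases "emeasure M (?E v) = 0")
      case True
      then have "AE w in M. w \<notin> ?E v" by (intro AE_not_in) auto
      then have "(\<integral>\<^sup>+w. indicator C (X w, v) * indicator (?E v) w \<partial>M) = (\<integral>\<^sup>+w. 0 \<partial>M)"
        by (intro nn_integral_cong_AE) auto
      then show ?thesis by simp
    next
      case False
      \<comment> \<open>The almost sure bound is constant on the fiber of \<open>v\<close>; if it
        failed there, the whole fiber would be null.\<close>
      have "1 \<le> K * measure M (?E v)"
      proof (rule ccontr)
        assume neg: "\<not> 1 \<le> K * measure M (?E v)"
        have "AE w in M. w \<notin> ?E v" using atoms by eventually_elim (use neg in auto)
        then have "emeasure M (?E v) = 0" by (subst (asm) AE_iff_measurable[of "?E v"]) (auto)
        with False show False by simp
      qed
      then have "1 \<le> ennreal K * emeasure M (?E v)"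
        by (simp add: emeasure_eq_measure ennreal_mult''[symmetric])
      then have "a v * 1 \<le> a v * (ennreal K * emeasure M (?E v))" by (intro mult_left_mono) auto
      moreover have "(\<integral>\<^sup>+w. indicator C (X w, v) * indicator (?E v) w \<partial>M) \<le> a v"
        unfolding a_def by (intro nn_integral_mono) (auto simp: indicator_def)
      ultimately show ?thesis by (simp add: ac_simps)
    qed
  qed
  also have "\<dots> = ennreal K * (\<integral>\<^sup>+w. a (V w) \<partial>M)"
    by (subst nn_integral_finite_range[OF fin, where f="\<lambda>w v. a v"])
       (auto simp: sum_distrib_left nn_integral_cmult_indicator)
  also have "(\<integral>\<^sup>+w. a (V w) \<partial>M) = emeasure (distr M S X \<Otimes>\<^sub>M distr M T V) C"
  proof -
    have "emeasure (distr M S X \<Otimes>\<^sub>M distr M T V) C =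
       (\<integral>\<^sup>+v. emeasure (distr M S X) ((\<lambda>x. (x, v)) -` C) \<partial>distr M T V)"
      by (rule XY.emeasure_pair_measure_alt2) simp
    also have "\<dots> = (\<integral>\<^sup>+w. emeasure (distr M S X) ((\<lambda>x. (x, V w)) -` C) \<partial>M)"
      using XY.measurable_emeasure_Pair2[of C] by (subst nn_integral_distr) auto
    also have "\<dots> = (\<integral>\<^sup>+w. a (V w) \<partial>M)"
    proof (rule nn_integral_cong)
      fix w assume w: "w \<in> space M"
      have Cv: "(\<lambda>x. (x, V w)) -` C \<in> sets S" using sets_Pair2[OF C] .
      have "a (V w) = (\<integral>\<^sup>+w'. indicator ((\<lambda>x. (x, V w)) -` C) (X w') \<partial>M)"
        unfolding a_def by (intro nn_integral_cong) (auto simp: indicator_def)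
      also have "\<dots> = (\<integral>\<^sup>+x. indicator ((\<lambda>x. (x, V w)) -` C) x \<partial>distr M S X)"
        using Cv by (subst nn_integral_distr) auto
      also have "\<dots> = emeasure (distr M S X) ((\<lambda>x. (x, V w)) -` C)" using Cv by simp
      finally show "emeasure (distr M S X) ((\<lambda>x. (x, V w)) -` C) = a (V w)" by simp
    qed
    finally show ?thesis by simp
  qed
  finally show ?thesis .
qed

text \<open>Only finiteness of the rate matters, so the logarithm of the reciprocal of the smallest
  positive atom is good enough in place of the entropy of \<open>V\<close>.\<close>

lemma mutual_info_finite_range_bounded:
  assumes M: "prob_space M" and X[measurable]: "X \<in> M \<rightarrow>\<^sub>M S" and V[measurable]: "V \<in> M \<rightarrow>\<^sub>M T"
    and fin: "finite (V ` space M)" and Em[measurable]: "\<And>v. V -` {v} \<inter> space M \<in> sets M"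
  shows "\<exists>R\<ge>0. mutual_info M S T X V \<le> ereal R"
proof -
  interpret prob_space M by fact
  let ?p = "\<lambda>v. measure M (V -` {v} \<inter> space M)"
  \<comment> \<open>Null atoms enter the maximum harmlessly as \<open>1 / 0 = 0\<close>. Inserting 1
    gives \<open>K \<ge> 1\<close>, so that the resulting rate \<open>log 2 K\<close> is
    nonnegative.\<close>
  define K where "K = Max (insert 1 ((\<lambda>v. 1 / ?p v) ` V ` space M))"
  have K: "1 \<le> K" "\<And>w. w \<in> space M \<Longrightarrow> 1 / ?p (V w) \<le> K"
    unfolding K_def using fin by (auto intro!: Max_ge)
  have "AE w in M. \<forall>v\<in>V ` space M. ?p v = 0 \<longrightarrow> w \<notin> V -` {v} \<inter> space M"
  proof (subst AE_finite_all[OF fin], rule ballI)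
    fix v
    have "AE w in M. w \<notin> V -` {v} \<inter> space M" if "?p v = 0"
      by (rule AE_not_in) (use that Em in \<open>simp add: null_sets_def emeasure_eq_measure\<close>)
    then show "AE w in M. ?p v = 0 \<longrightarrow> w \<notin> V -` {v} \<inter> space M"
      by (cases "?p v = 0") simp_all
  qed
  with AE_space have atoms: "AE w in M. 1 \<le> K * ?p (V w)"
  proof eventually_elim
    case (elim w)
    then have "?p (V w) \<noteq> 0" by auto
    then have "?p (V w) > 0" by (simp add: zero_less_measure_iff)
    then show ?case using K(2)[OF elim(1)] by (simp add: field_simps)
  qed
  have "mutual_info M S T X V \<le> ereal (log 2 K)"
    unfolding mutual_info_def
  proof (rule KL_ext_le)
    show "prob_space (distr M S X \<Otimes>\<^sub>M distr M T V)"
      by (intro prob_space_pair prob_space_distr) auto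
    show "prob_space (distr M (S \<Otimes>\<^sub>M T) (\<lambda>w. (X w, V w)))" by (intro prob_space_distr) auto
    fix C assume "C \<in> sets (distr M S X \<Otimes>\<^sub>M distr M T V)"
    then have "C \<in> sets (S \<Otimes>\<^sub>M T)" by (simp cong: sets_pair_measure_cong)
    then show "emeasure (distr M (S \<Otimes>\<^sub>M T) (\<lambda>w. (X w, V w))) C
       \<le> ennreal K * emeasure (distr M S X \<Otimes>\<^sub>M distr M T V) C"
      by (rule distr_pair_le_product[OF M X V fin Em atoms])
  qed (simp cong: sets_pair_measure_cong)
  moreover have "log 2 K \<ge> 0" using K by simp
  ultimately show ?thesis by blast
qed

text \<open>The hypothesis says that, given \<open>U\<close>, the realized value of \<open>Y\<close>
  almost surely has conditional probability at least \<open>1 / K\<close>. So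
  \<open>distr_pair_le_product\<close> applies under the conditional measure of each fiber of
  \<open>U\<close>, and the fiberwise dominations add up to one by
  \<open>cond_indep_law\<close>.\<close>

lemma cond_mutual_info_finite_range_le:
  assumes P: "prob_space P"
    and [measurable]: "X \<in> borel_measurable P" "Y \<in> borel_measurable P" "U \<in> borel_measurable P"
    and fin: "finite (U ` space P)" "finite (Y ` space P)"
    and atoms: "AE w in P. measure P (U -` {U w} \<inter> space P)
      \<le> K * measure P (U -` {U w} \<inter> (Y -` {Y w} \<inter> space P))"
  shows "cond_mutual_info P X Y U \<le> ereal (log 2 K)"
proof -
  interpret prob_space P by fact
  let ?b = "borel :: real measure"
  let ?N = "?b \<Otimes>\<^sub>M ?b \<Otimes>\<^sub>M ?b"
  let ?W = "fiber_law P borel X U" and ?V = "fiber_law P borel Y U" and ?E = "\<lambda>u. U -` {u} \<inter> space P"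
  let ?k = "\<lambda>u. distr (?W u \<Otimes>\<^sub>M ?V u) ?N (\<lambda>(x, y). (x, y, u))"
  have cW: "is_cond_distr P borel borel X U ?W" and cV: "is_cond_distr P borel borel Y U ?V"
    by (intro is_cond_distr_fiber_law P fin; simp)+
  have [measurable]: "?W \<in> borel \<rightarrow>\<^sub>M prob_algebra borel" "?V \<in> borel \<rightarrow>\<^sub>M prob_algebra borel"
    using cW cV by (auto simp: is_cond_distr_def)
  have k[measurable]: "?k \<in> borel \<rightarrow>\<^sub>M prob_algebra ?N" by measurable
  have L: "distr P borel U \<in> space (prob_algebra borel)"
    by (simp add: space_prob_algebra prob_space_distr)
  have Em[measurable]: "?E u \<in> sets P" for u by measurable
  have Q: "cond_indep_law P X Y U = distr P borel U \<bind> ?k"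
    by (rule cond_indep_law_eq[OF P _ _ _ cW cV]) auto
  have setsQ: "sets (cond_indep_law P X Y U) = sets ?N"
    unfolding Q by (rule sets_bind'[OF L k])
  show ?thesis unfolding cond_mutual_info_def
  proof (rule KL_ext_le)
    show "prob_space (cond_indep_law P X Y U)" unfolding Q by (rule prob_space_bind'[OF L k])
    show "prob_space (distr P ?N (\<lambda>w. (X w, Y w, U w)))" by (intro prob_space_distr) auto
    show "sets (distr P ?N (\<lambda>w. (X w, Y w, U w))) = sets (cond_indep_law P X Y U)"
      using setsQ by simp
    fix C assume "C \<in> sets (cond_indep_law P X Y U)"
    then have C[measurable]: "C \<in> sets ?N" using setsQ by simp
    have "emeasure (distr P ?N (\<lambda>w. (X w, Y w, U w))) C = (\<integral>\<^sup>+w. indicator C (X w, Y w, U w) \<partial>P)"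
      by (subst nn_integral_indicator[symmetric], simp, subst nn_integral_distr) auto
    also have "\<dots> = (\<Sum>u\<in>U ` space P. \<integral>\<^sup>+w. indicator C (X w, Y w, u) * indicator (?E u) w \<partial>P)"
      by (rule nn_integral_finite_range[OF fin(1)]) auto
    also have "\<dots> \<le> (\<Sum>u\<in>U ` space P. ennreal K * (emeasure (?k u) C * emeasure P (?E u)))"
    proof (rule sum_mono)
      fix u
      show "(\<integral>\<^sup>+w. indicator C (X w, Y w, u) * indicator (?E u) w \<partial>P)
        \<le> ennreal K * (emeasure (?k u) C * emeasure P (?E u))"
      proof (cases "emeasure P (?E u) = 0")
        case True
        then have "AE w in P. w \<notin> ?E u" by (intro AE_not_in) auto
        then have "(\<integral>\<^sup>+w. indicator C (X w, Y w, u) * indicator (?E u) w \<partial>P) = (\<integral>\<^sup>+w. 0 \<partial>P)"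
          by (intro nn_integral_cong_AE) auto
        then show ?thesis by simp
      next
        case False
        let ?M = "uniform_measure P (?E u)"
        have pM: "prob_space ?M" using prob_space_fiber[OF P False] .
        \<comment> \<open>Slicing \<open>C\<close> at \<open>u\<close> leaves a two-variable claim
          about \<open>X\<close> and \<open>Y\<close> under the conditional measure
          \<open>?M\<close>.\<close>
        define D where "D = {(x, y). (x, y, u) \<in> C}"
        have D[measurable]: "D \<in> sets (?b \<Otimes>\<^sub>M ?b)"
        proof -
          have "D = (\<lambda>(x, y). (x, y, u)) -` C \<inter> space (?b \<Otimes>\<^sub>M ?b)" by (auto simp: D_def space_pair_measure)
          also have "\<dots> \<in> sets (?b \<Otimes>\<^sub>M ?b)" by (rule measurable_sets[OF _ C]) measurable
          finally show ?thesis .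
        qed
        have WV: "?W u = distr ?M borel X" "?V u = distr ?M borel Y"
          using False by (simp_all add: fiber_law_def)
        have mM: "borel_measurable ?M = borel_measurable P" by (auto cong: measurable_cong_sets)
        have kD: "emeasure (?k u) C = emeasure (distr ?M borel X \<Otimes>\<^sub>M distr ?M borel Y) D"
        proof -
          have "emeasure (?k u) C = emeasure (distr ?M borel X \<Otimes>\<^sub>M distr ?M borel Y)
             ((\<lambda>(x, y). (x, y, u)) -` C \<inter> space (distr ?M borel X \<Otimes>\<^sub>M distr ?M borel Y))"
            unfolding WV by (rule emeasure_distr) measurable
          also have "(\<lambda>(x, y). (x, y, u)) -` C \<inter> space (distr ?M borel X \<Otimes>\<^sub>M distr ?M borel Y) = D"
            by (auto simp: D_def space_pair_measure)
          finally show ?thesis .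
        qed
        have "(\<integral>\<^sup>+w. indicator C (X w, Y w, u) * indicator (?E u) w \<partial>P)
            = (\<integral>\<^sup>+w. indicator C (X w, Y w, u) \<partial>?M) * emeasure P (?E u)"
          using False by (subst nn_integral_uniform_measure)
            (auto simp: ennreal_divide_times ennreal_divide_self emeasure_eq_measure)
        also have "(\<integral>\<^sup>+w. indicator C (X w, Y w, u) \<partial>?M) = (\<integral>\<^sup>+w. indicator D (X w, Y w) \<partial>?M)"
          by (intro nn_integral_cong) (auto simp: D_def indicator_def)
        also have "\<dots> = emeasure (distr ?M (?b \<Otimes>\<^sub>M ?b) (\<lambda>w. (X w, Y w))) D"
          by (subst nn_integral_indicator[symmetric], simp, subst nn_integral_distr) auto
        also have "\<dots> \<le> ennreal K * emeasure (distr ?M borel X \<Otimes>\<^sub>M distr ?M borel Y) D"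
        proof (rule distr_pair_le_product[OF pM])
          have p: "measure P (?E u) > 0" using False by (simp add: emeasure_eq_measure zero_less_measure_iff)
          show "AE w in ?M. 1 \<le> K * measure ?M (Y -` {Y w} \<inter> space ?M)"
          proof (subst AE_uniform_measure)
            show "AE w in P. w \<in> ?E u \<longrightarrow> 1 \<le> K * measure ?M (Y -` {Y w} \<inter> space ?M)"
              using atoms
            proof (eventually_elim, intro impI)
              fix w assume w: "measure P (?E (U w)) \<le> K * measure P (U -` {U w} \<inter> (Y -` {Y w} \<inter> space P))"
                "w \<in> ?E u"
              have "measure ?M (Y -` {Y w} \<inter> space ?M)
                 = measure P (?E u \<inter> (Y -` {Y w} \<inter> space P)) / measure P (?E u)"
                using False by (subst measure_uniform_measure) auto
              also have "?E u \<inter> (Y -` {Y w} \<inter> space P) = U -` {U w} \<inter> (Y -` {Y w} \<inter> space P)"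
                using w(2) by auto
              finally have "measure ?M (Y -` {Y w} \<inter> space ?M)
                 = measure P (U -` {U w} \<inter> (Y -` {Y w} \<inter> space P)) / measure P (?E u)" .
              then show "1 \<le> K * measure ?M (Y -` {Y w} \<inter> space ?M)"
                using w p by (simp add: pos_le_divide_eq)
            qed
          qed (use False in \<open>auto simp: emeasure_eq_measure\<close>)
        qed (use fin in \<open>auto simp: mM\<close>)
        finally show ?thesis unfolding kD
          by (simp add: mult.assoc mult_right_mono)
      qed
    qed
    also have "\<dots> = ennreal K * (\<integral>\<^sup>+w. emeasure (?k (U w)) C \<partial>P)"
      by (subst nn_integral_finite_range[OF fin(1), where f="\<lambda>w u. emeasure (?k u) C"])
         (auto simp: sum_distrib_left nn_integral_cmult_indicator)
    also have "(\<integral>\<^sup>+w. emeasure (?k (U w)) C \<partial>P) = (\<integral>\<^sup>+u. emeasure (?k u) C \<partial>distr P borel U)"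
      by (subst nn_integral_distr) (auto intro!: measurable_emeasure_kernel measurable_prob_algebraD k)
    also have "\<dots> = emeasure (cond_indep_law P X Y U) C"
      unfolding Q by (rule emeasure_bind_prob_algebra[OF L k C, symmetric])
    finally show "emeasure (distr P ?N (\<lambda>w. (X w, Y w, U w))) C
      \<le> ennreal K * emeasure (cond_indep_law P X Y U) C" .
  qed
qed

section \<open>Gaussian laws\<close>

lemma integrable_mult_of_squares:
  fixes f g :: "'a \<Rightarrow> real"
  assumes [measurable]: "f \<in> borel_measurable M" "g \<in> borel_measurable M"
    and f: "integrable M (\<lambda>x. (f x)\<^sup>2)" and g: "integrable M (\<lambda>x. (g x)\<^sup>2)"
  shows "integrable M (\<lambda>x. f x * g x)"
proof (rule Bochner_Integration.integrable_bound[OF Bochner_Integration.integrable_add[OF f g]])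
  have "\<bar>a * b\<bar> \<le> a\<^sup>2 + b\<^sup>2" for a b :: real
    using sum_squares_bound[of "\<bar>a\<bar>" "\<bar>b\<bar>"] abs_ge_zero[of "a * b"]
    unfolding power2_abs abs_mult by linarith
  then show "AE x in M. norm (f x * g x) \<le> norm ((f x)\<^sup>2 + (g x)\<^sup>2)" by simp
qed simp

lemma normal_density_eq_distr_std:
  assumes "s > 0"
  shows "density lborel (\<lambda>x. ennreal (normal_density m s x)) =
    distr std_normal_distribution borel (\<lambda>x. m + s * x)"
proof -
  interpret prob_space std_normal_distribution by (rule prob_space_normal_density) simp
  have "distributed std_normal_distribution lborel (\<lambda>x. x) (\<lambda>x. ennreal (std_normal_density x))"
    unfolding distributed_def by (auto simp: distr_id2)
  from normal_density_affine[OF this, of s m] assms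
  have "distributed std_normal_distribution lborel (\<lambda>x. m + s * x) (\<lambda>x. ennreal (normal_density m s x))"
    by simp
  then have "distr std_normal_distribution lborel (\<lambda>x. m + s * x) = density lborel (\<lambda>x. ennreal (normal_density m s x))"
    by (simp add: distributed_def)
  then show ?thesis by (simp cong: distr_cong)
qed

lemma gaussian_law_shift:
  assumes "gaussian_law N"
  shows "gaussian_law (distr N borel (\<lambda>x. x + c))"
  using assms unfolding gaussian_law_def
proof (elim disjE exE conjE)
  fix m assume "N = return borel m"
  then show "(\<exists>m. distr N borel (\<lambda>x. x + c) = return borel m) \<or>
      (\<exists>m s. 0 < s \<and> distr N borel (\<lambda>x. x + c) = density lborel (\<lambda>x. ennreal (normal_density m s x)))"
    by (auto simp: distr_return)
next
  fix m s :: real assume s: "0 < s" and N: "N = density lborel (\<lambda>x. ennreal (normal_density m s x))"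
  have "distr N borel (\<lambda>x. x + c) = distr std_normal_distribution borel (\<lambda>x. (m + c) + s * x)"
    unfolding N normal_density_eq_distr_std[OF s]
    by (subst distr_distr) (auto simp: comp_def algebra_simps)
  then show "(\<exists>m. distr N borel (\<lambda>x. x + c) = return borel m) \<or>
      (\<exists>m s. 0 < s \<and> distr N borel (\<lambda>x. x + c) = density lborel (\<lambda>x. ennreal (normal_density m s x)))"
    using s normal_density_eq_distr_std[OF s, of "m + c"] by metis
qed

lemma normal_distribution_moments:
  fixes m s :: real
  assumes s: "s > 0"
  defines "N \<equiv> density lborel (\<lambda>x. ennreal (normal_density m s x))"
  shows "integrable N (\<lambda>x. x\<^sup>2)" "(\<integral>x. x \<partial>N) = m" "(\<integral>x. (x - m)\<^sup>2 \<partial>N) = s\<^sup>2"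
    "integrable N (\<lambda>x. (x - m) ^ 4)" "(\<integral>x. (x - m) ^ 4 \<partial>N) = 3 * s ^ 4"
proof -
  show "(\<integral>x. x \<partial>N) = m" unfolding N_def
    using integral_normal_moment_nz_1[OF s, of m] by (subst integral_density) auto
  show "(\<integral>x. (x - m)\<^sup>2 \<partial>N) = s\<^sup>2" unfolding N_def
    using integral_normal_moment_even[OF s, of m 1] by (subst integral_density) (auto simp: fact_numeral)
  show "integrable N (\<lambda>x. (x - m) ^ 4)" unfolding N_def
    using integrable_normal_moment[OF s, of m 4] by (subst integrable_density) auto
  show "(\<integral>x. (x - m) ^ 4 \<partial>N) = 3 * s ^ 4" unfolding N_def
    using integral_normal_moment_even[OF s, of m 2]
    by (subst integral_density) (auto simp: fact_numeral power_divide field_simps)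
  have "integrable N (\<lambda>x. (x - m)\<^sup>2)" unfolding N_def
    using integrable_normal_moment[OF s, of m 2] by (subst integrable_density) auto
  moreover have "integrable N (\<lambda>x. x)" unfolding N_def
    using integrable_normal_moment_nz_1[OF s, of m] by (subst integrable_density) auto
  moreover have "integrable N (\<lambda>x. 1)"
    using prob_space_normal_density[OF s, of m] unfolding N_def
    by (intro finite_measure.integrable_const prob_space.finite_measure)
  ultimately have "integrable N (\<lambda>x. (x - m)\<^sup>2 + 2 * m * x - m\<^sup>2 * 1)"
    by (intro Bochner_Integration.integrable_diff Bochner_Integration.integrable_add integrable_mult_right)
  then show "integrable N (\<lambda>x. x\<^sup>2)"
    by (rule back_subst[where P="integrable N"]) (auto simp: power2_eq_square algebra_simps)
qed

text \<open>One formula in mean and variance covers point masses and proper normal laws alike, so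
  degenerate linear combinations need no separate treatment later.\<close>

lemma gaussian_lawD:
  assumes N: "gaussian_law N"
  defines "m \<equiv> \<integral>x. x \<partial>N"
  shows "real_distribution N" "integrable N (\<lambda>x. x\<^sup>2)"
    "char N t = iexp (t * m) * exp (- (t\<^sup>2 * (\<integral>x. (x - m)\<^sup>2 \<partial>N)) / 2)"
proof -
  have "real_distribution N \<and> integrable N (\<lambda>x. x\<^sup>2) \<and>
    char N t = iexp (t * m) * exp (- (t\<^sup>2 * (\<integral>x. (x - m)\<^sup>2 \<partial>N)) / 2)"
    using N unfolding gaussian_law_def
  proof (elim disjE exE conjE)
    fix a assume Na: "N = return borel a"
    interpret prob_space N unfolding Na by (rule prob_space_return) simp
    have r: "real_distribution N"
      by (intro real_distribution.intro real_distribution_axioms.intro prob_space_axioms) (auto simp: Na)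
    have m: "m = a" unfolding m_def Na by (subst integral_return) auto
    have "integrable N (\<lambda>x. x\<^sup>2)"
    proof -
      have "AE x in N. x = a" unfolding Na by (subst AE_return) auto
      then have "AE x in N. norm (x\<^sup>2) \<le> a\<^sup>2" by eventually_elim simp
      then show ?thesis by (intro integrable_const_bound[where B="a\<^sup>2"]) (auto simp: Na)
    qed
    moreover have "char N t = iexp (t * a)" unfolding Na char_def by (subst integral_return) auto
    moreover have "(\<integral>x. (x - m)\<^sup>2 \<partial>N) = 0" unfolding m Na by (subst integral_return) auto
    ultimately show ?thesis using r m by simp
  next
    fix a s :: real assume s: "0 < s" and Na: "N = density lborel (\<lambda>x. ennreal (normal_density a s x))"
    interpret prob_space N unfolding Na using s by (rule prob_space_normal_density)
    have r: "real_distribution N"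
      by (intro real_distribution.intro real_distribution_axioms.intro prob_space_axioms) (auto simp: Na)
    note mom = normal_distribution_moments[OF s, of a, folded Na]
    have m: "m = a" using mom m_def by simp
    interpret S: real_distribution std_normal_distribution by (rule real_dist_normal_dist)
    have "char N t = (CLINT x|std_normal_distribution. iexp (t * (a + s * x)))"
      unfolding Na char_def normal_density_eq_distr_std[OF s] by (subst integral_distr) auto
    also have "\<dots> = (CLINT x|std_normal_distribution. iexp (t * a) * iexp ((t * s) * x))"
      by (simp add: exp_add[symmetric] algebra_simps)
    also have "\<dots> = iexp (t * a) * char std_normal_distribution (t * s)"
      unfolding char_def by (rule integral_mult_right_zero)
    also have "char std_normal_distribution (t * s) = exp (- (t * s)\<^sup>2 / 2)"
      by (simp add: char_std_normal_distribution)
    finally have "char N t = iexp (t * a) * exp (- (t\<^sup>2 * s\<^sup>2) / 2)"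
      by (simp add: power_mult_distrib)
    then show ?thesis using r m mom by simp
  qed
  then show "real_distribution N" "integrable N (\<lambda>x. x\<^sup>2)"
    "char N t = iexp (t * m) * exp (- (t\<^sup>2 * (\<integral>x. (x - m)\<^sup>2 \<partial>N)) / 2)" by auto
qed

text \<open>At \<open>t = 0\<close> the hypothesis says that \<open>h\<close> has mean one, so
  \<open>h\<close> is a probability density with respect to \<open>P\<close>. For general
  \<open>t\<close> it says that \<open>U\<close> has the same characteristic function under
  \<open>P\<close> and under the tilted measure, hence the same law.\<close>

lemma integral_tilt_eq:
  fixes h U :: "'w \<Rightarrow> real"
  assumes P: "prob_space P" and U[measurable]: "U \<in> borel_measurable P"
    and h[measurable]: "h \<in> borel_measurable P" and h0: "\<And>w. 0 \<le> h w" and hi: "integrable P h"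
    and eq: "\<And>t. (CLINT w|P. h w *\<^sub>R iexp (t * U w)) = (CLINT w|P. iexp (t * U w))"
    and B[measurable]: "B \<in> sets borel"
  shows "(\<integral>w. h w * indicator B (U w) \<partial>P) = (\<integral>w. indicator B (U w) \<partial>P)"
proof -
  interpret P: prob_space P by fact
  let ?D = "density P (\<lambda>w. ennreal (h w))"
  have "complex_of_real (\<integral>w. h w \<partial>P) = 1"
    using eq[of 0] P.prob_space by (simp add: scaleR_conv_of_real)
  then have h1: "(\<integral>w. h w \<partial>P) = 1" by (metis of_real_eq_1_iff)
  have D: "prob_space ?D"
  proof
    have "emeasure ?D (space ?D) = (\<integral>\<^sup>+w. ennreal (h w) \<partial>P)"
      by (subst emeasure_density) (auto intro!: nn_integral_cong)
    also have "\<dots> = 1" using h1 h0 hi by (subst nn_integral_eq_integral) auto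
    finally show "emeasure ?D (space ?D) = 1" .
  qed
  interpret D: prob_space ?D by fact
  have "distr ?D borel U = distr P borel U"
  proof (rule Levy_uniqueness)
    show "char (distr ?D borel U) = char (distr P borel U)"
    proof
      fix t
      show "char (distr ?D borel U) t = char (distr P borel U) t"
        unfolding char_def using eq[of t] h0
        by (subst (1 2) integral_distr, simp, simp, simp, simp, subst integral_density) auto
    qed
  qed (auto intro!: D.real_distribution_distr P.real_distribution_distr)
  then have "(\<integral>x. indicator B x \<partial>distr ?D borel U) = (\<integral>x. indicator B x \<partial>distr P borel U :: real)"
    by simp
  then show ?thesis using h0
    by (subst (asm) (1 2) integral_distr, simp, simp, simp, simp, subst (asm) integral_density) auto
qed

text \<open>
  Uniqueness of characteristic functions is only available on the line, so it is applied twice: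
  first to the law of \<open>U\<close> under \<open>P\<close> tilted by \<open>1 + cos (s Z)\<close> and by \<open>1 + sin (s Z)\<close>,
  then to the law of \<open>Z\<close> conditioned on \<open>U \<in> B\<close>.
\<close>

lemma distr_pair_eq_product_of_uncorrelated_gaussian:
  fixes Z U :: "'w \<Rightarrow> real"
  assumes P: "prob_space P" and Z[measurable]: "Z \<in> borel_measurable P" and U[measurable]: "U \<in> borel_measurable P"
    and G: "\<And>a b. gaussian_law (distr P borel (\<lambda>w. a * Z w + b * U w))"
    and Z0: "(\<integral>w. Z w \<partial>P) = 0" and ZU: "(\<integral>w. Z w * U w \<partial>P) = 0"
  shows "distr P (borel \<Otimes>\<^sub>M borel) (\<lambda>w. (Z w, U w)) = distr P borel Z \<Otimes>\<^sub>M distr P borel U"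
proof -
  interpret P: prob_space P by fact
  have sq: "integrable P (\<lambda>w. (a * Z w + b * U w)\<^sup>2)" for a b
    using gaussian_lawD(2)[OF G[of a b]] by (subst (asm) integrable_distr_eq) auto
  have Z2[simp]: "integrable P (\<lambda>w. (Z w)\<^sup>2)" and U2[simp]: "integrable P (\<lambda>w. (U w)\<^sup>2)"
    using sq[of 1 0] sq[of 0 1] by simp_all
  have ZUi[simp]: "integrable P (\<lambda>w. Z w * U w)" by (rule integrable_mult_of_squares[OF Z U Z2 U2])
  have Zi[simp]: "integrable P Z" and Ui[simp]: "integrable P U"
    using P.square_integrable_imp_integrable[OF Z Z2] P.square_integrable_imp_integrable[OF U U2] by auto
  define mU where "mU = (\<integral>w. U w \<partial>P)"
  define vZ where "vZ = (\<integral>w. (Z w)\<^sup>2 \<partial>P)"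
  define vU where "vU = (\<integral>w. (U w - mU)\<^sup>2 \<partial>P)"
  \<comment> \<open>Zero covariance makes the variance of \<open>s * Z + t * U\<close> a sum, so the
    Gaussian exponent splits. The real factor is the characteristic function of the centered
    variable \<open>Z\<close> at \<open>s\<close>.\<close>
  have ch: "(CLINT w|P. iexp (s * Z w + t * U w)) =
    complex_of_real (exp (- (s\<^sup>2 * vZ) / 2)) * (CLINT w|P. iexp (t * U w))" for s t
  proof -
    have gen: "(CLINT w|P. iexp (s * Z w + t * U w)) =
        iexp (t * mU) * exp (- (s\<^sup>2 * vZ + t\<^sup>2 * vU) / 2)" for s t
    proof -
      let ?N = "distr P borel (\<lambda>w. s * Z w + t * U w)"
      have m: "(\<integral>x. x \<partial>?N) = t * mU"
        by (subst integral_distr) (auto simp: Z0 mU_def)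
      have v: "(\<integral>x. (x - t * mU)\<^sup>2 \<partial>?N) = s\<^sup>2 * vZ + t\<^sup>2 * vU"
      proof -
        have "(\<integral>x. (x - t * mU)\<^sup>2 \<partial>?N) = (\<integral>w. (s * Z w + t * U w - t * mU)\<^sup>2 \<partial>P)"
          by (subst integral_distr) auto
        also have "\<dots> = (\<integral>w. s\<^sup>2 * (Z w)\<^sup>2 + t\<^sup>2 * (U w - mU)\<^sup>2 + 2 * s * t * (Z w * U w) - 2 * s * t * mU * Z w \<partial>P)"
          by (rule Bochner_Integration.integral_cong) (auto simp: power2_eq_square algebra_simps)
        also have "\<dots> = s\<^sup>2 * vZ + t\<^sup>2 * vU"
        proof -
          have "integrable P (\<lambda>w. (U w - mU)\<^sup>2)" by (simp add: power2_diff)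
          then show ?thesis by (simp add: Z0 ZU vZ_def vU_def)
        qed
        finally show ?thesis .
      qed
      have "char ?N 1 = iexp (t * mU) * exp (- (s\<^sup>2 * vZ + t\<^sup>2 * vU) / 2)"
        using gaussian_lawD(3)[OF G[of s t], of 1] unfolding m v by simp
      moreover have "char ?N 1 = (CLINT w|P. iexp (s * Z w + t * U w))"
        unfolding char_def by (subst integral_distr) auto
      ultimately show ?thesis by simp
    qed
    have "(CLINT w|P. iexp (t * U w)) = iexp (t * mU) * exp (- (t\<^sup>2 * vU) / 2)"
      using gen[of 0 t] by simp
    moreover have "exp (- (s\<^sup>2 * vZ + t\<^sup>2 * vU) / 2) = exp (- (s\<^sup>2 * vZ) / 2) * exp (- (t\<^sup>2 * vU) / 2)"
      unfolding exp_add[symmetric] by (simp add: field_simps)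
    ultimately show ?thesis unfolding gen[of s t]
      by (simp only: of_real_mult mult_ac)
  qed
  have ie: "integrable P (\<lambda>w. iexp (f w))" if [measurable]: "f \<in> borel_measurable P" for f
    by (rule P.integrable_const_bound[where B=1]) auto
  have ieb: "integrable P (\<lambda>w. h w *\<^sub>R iexp (f w))"
    if [measurable]: "f \<in> borel_measurable P" "h \<in> borel_measurable P" and "\<And>w. \<bar>h w\<bar> \<le> 1" for f h
    by (rule P.integrable_const_bound[where B=1]) (use that in auto)
  have cos_t: "(CLINT w|P. cos (s * Z w) *\<^sub>R iexp (t * U w)) =
      complex_of_real (exp (- (s\<^sup>2 * vZ) / 2)) * (CLINT w|P. iexp (t * U w))" for s t
  proof -
    have "(CLINT w|P. cos (s * Z w) *\<^sub>R iexp (t * U w)) =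
       (CLINT w|P. (iexp (s * Z w + t * U w) + iexp ((-s) * Z w + t * U w)) / 2)"
      by (rule Bochner_Integration.integral_cong)
        (auto simp: complex_eq_iff Re_exp Im_exp cos_add sin_add cos_diff sin_diff)
    also have "\<dots> = ((CLINT w|P. iexp (s * Z w + t * U w)) + (CLINT w|P. iexp ((-s) * Z w + t * U w))) / 2"
      by (simp only: integral_divide_zero) (subst Bochner_Integration.integral_add[OF ie ie]; (rule refl | measurable))
    also have "\<dots> = complex_of_real (exp (- (s\<^sup>2 * vZ) / 2)) * (CLINT w|P. iexp (t * U w))"
      unfolding ch[of s t] ch[of "-s" t] by simp
    finally show ?thesis .
  qed
  \<comment> \<open>By \<open>ch\<close> the factor contributed by \<open>Z\<close> is even in
    \<open>s\<close>: the terms for \<open>s\<close> and \<open>-s\<close> cancel here, whereas in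
    \<open>cos_t\<close> they average to that factor.\<close>
  have sin_t: "(CLINT w|P. sin (s * Z w) *\<^sub>R iexp (t * U w)) = 0" for s t
  proof -
    have "(CLINT w|P. sin (s * Z w) *\<^sub>R iexp (t * U w)) =
       (CLINT w|P. (iexp (s * Z w + t * U w) - iexp ((-s) * Z w + t * U w)) / (2 * \<i>))"
      by (rule Bochner_Integration.integral_cong)
        (auto simp: complex_eq_iff Re_exp Im_exp cos_add sin_add cos_diff sin_diff Re_divide Im_divide power2_eq_square)
    also have "\<dots> = ((CLINT w|P. iexp (s * Z w + t * U w)) - (CLINT w|P. iexp ((-s) * Z w + t * U w))) / (2 * \<i>)"
      by (simp only: integral_divide_zero) (subst Bochner_Integration.integral_diff[OF ie ie]; (rule refl | measurable))
    also have "\<dots> = 0"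
      unfolding ch[of s t] ch[of "-s" t] by simp
    finally show ?thesis .
  qed
  have cosB: "(\<integral>w. cos (s * Z w) * indicator B (U w) \<partial>P) = exp (- (s\<^sup>2 * vZ) / 2) * (\<integral>w. indicator B (U w) \<partial>P)"
    and sinB: "(\<integral>w. sin (s * Z w) * indicator B (U w) \<partial>P) = 0"
    if B[measurable]: "B \<in> sets borel" for s B
  proof -
    define c where "c = exp (- (s\<^sup>2 * vZ) / 2)"
    have c: "c > 0" unfolding c_def by simp
    have sc: "((1 + x) / k) *\<^sub>R z = (1 / k) *\<^sub>R (z + x *\<^sub>R z)" for x k :: real and z :: complex
      by (simp add: scaleR_add_right scaleR_add_left add_divide_distrib)
    have ci: "integrable P (\<lambda>w. cos (s * Z w))" "integrable P (\<lambda>w. sin (s * Z w))"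
      by (rule P.integrable_const_bound[where B=1]; simp)+
    have bi: "integrable P (\<lambda>w. h w * indicator B (U w))"
      if [measurable]: "h \<in> borel_measurable P" and "\<And>w. \<bar>h w\<bar> \<le> 1" for h :: "'w \<Rightarrow> real"
      by (rule P.integrable_const_bound[where B=1]) (use that in \<open>auto simp: indicator_def\<close>)
    have bi1: "integrable P (\<lambda>w. indicator B (U w) :: real)" using bi[of "\<lambda>_. 1"] by simp
    \<comment> \<open>A tilt must be nonnegative with mean one. The cosine has mean
      \<open>c\<close>, which explains adding 1 and dividing by \<open>1 + c\<close>; for the sine,
      whose mean is zero, adding 1 is enough.\<close>
    have "(\<integral>w. ((1 + cos (s * Z w)) / (1 + c)) * indicator B (U w) \<partial>P) = (\<integral>w. indicator B (U w) \<partial>P)"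
    proof (rule integral_tilt_eq[OF P U _ _ _ _ B])
      show "0 \<le> (1 + cos (s * Z w)) / (1 + c)" for w
        using c cos_ge_minus_one[of "s * Z w"] by (intro divide_nonneg_pos) linarith+
      show "integrable P (\<lambda>w. (1 + cos (s * Z w)) / (1 + c))"
        by (intro integrable_divide Bochner_Integration.integrable_add P.integrable_const ci)
      fix t
      have "(CLINT w|P. ((1 + cos (s * Z w)) / (1 + c)) *\<^sub>R iexp (t * U w)) =
         (CLINT w|P. (1 / (1 + c)) *\<^sub>R (iexp (t * U w) + cos (s * Z w) *\<^sub>R iexp (t * U w)))"
        unfolding sc ..
      also have "\<dots> = (1 / (1 + c)) *\<^sub>R ((CLINT w|P. iexp (t * U w)) + (CLINT w|P. cos (s * Z w) *\<^sub>R iexp (t * U w)))"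
        by (simp only: integral_scaleR_right) (subst Bochner_Integration.integral_add[OF ie ieb]; (rule refl | measurable | simp))
      also have "\<dots> = (1 / (1 + c)) *\<^sub>R ((1 + c) *\<^sub>R (CLINT w|P. iexp (t * U w)))"
        unfolding cos_t c_def[symmetric] by (simp add: scaleR_conv_of_real algebra_simps)
      also have "\<dots> = (CLINT w|P. iexp (t * U w))" using c by simp
      finally show "(CLINT w|P. ((1 + cos (s * Z w)) / (1 + c)) *\<^sub>R iexp (t * U w)) = (CLINT w|P. iexp (t * U w))" .
    qed auto
    moreover have "(\<integral>w. ((1 + cos (s * Z w)) / (1 + c)) * indicator B (U w) \<partial>P) =
       ((\<integral>w. indicator B (U w) \<partial>P) + (\<integral>w. cos (s * Z w) * indicator B (U w) \<partial>P)) / (1 + c)"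
    proof -
      have "(\<integral>w. ((1 + cos (s * Z w)) / (1 + c)) * indicator B (U w) \<partial>P) =
         (\<integral>w. (indicator B (U w) + cos (s * Z w) * indicator B (U w)) / (1 + c) \<partial>P)"
        by (simp add: distrib_right)
      also have "\<dots> = (\<integral>w. indicator B (U w) + cos (s * Z w) * indicator B (U w) \<partial>P) / (1 + c)"
        by (rule integral_divide_zero)
      also have "(\<integral>w. indicator B (U w) + cos (s * Z w) * indicator B (U w) \<partial>P) =
          (\<integral>w. indicator B (U w) \<partial>P) + (\<integral>w. cos (s * Z w) * indicator B (U w) \<partial>P)"
        by (rule Bochner_Integration.integral_add[OF bi1 bi]) auto
      finally show ?thesis .
    qed
    ultimately have "((\<integral>w. indicator B (U w) \<partial>P) + (\<integral>w. cos (s * Z w) * indicator B (U w) \<partial>P)) / (1 + c)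
        = (\<integral>w. indicator B (U w) \<partial>P)" by metis
    moreover have "a = c * b" if "(b + a) / (1 + c) = b" for a b :: real
      using that c by (simp add: field_simps)
    ultimately show "(\<integral>w. cos (s * Z w) * indicator B (U w) \<partial>P) = exp (- (s\<^sup>2 * vZ) / 2) * (\<integral>w. indicator B (U w) \<partial>P)"
      unfolding c_def[symmetric] by blast
    have "(\<integral>w. (1 + sin (s * Z w)) * indicator B (U w) \<partial>P) = (\<integral>w. indicator B (U w) \<partial>P)"
    proof (rule integral_tilt_eq[OF P U _ _ _ _ B])
      show "0 \<le> 1 + sin (s * Z w)" for w using sin_ge_minus_one[of "s * Z w"] by linarith
      show "integrable P (\<lambda>w. 1 + sin (s * Z w))"
        by (intro Bochner_Integration.integrable_add P.integrable_const ci)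
      fix t
      have "(CLINT w|P. (1 + sin (s * Z w)) *\<^sub>R iexp (t * U w)) =
         (CLINT w|P. iexp (t * U w)) + (CLINT w|P. sin (s * Z w) *\<^sub>R iexp (t * U w))"
        unfolding scaleR_add_left scaleR_one
        by (subst Bochner_Integration.integral_add[OF ie ieb]; (rule refl | measurable | simp))
      then show "(CLINT w|P. (1 + sin (s * Z w)) *\<^sub>R iexp (t * U w)) = (CLINT w|P. iexp (t * U w))"
        unfolding sin_t by simp
    qed auto
    moreover have "(\<integral>w. (1 + sin (s * Z w)) * indicator B (U w) \<partial>P) =
       (\<integral>w. indicator B (U w) \<partial>P) + (\<integral>w. sin (s * Z w) * indicator B (U w) \<partial>P)"
      unfolding distrib_right mult_1 by (rule Bochner_Integration.integral_add[OF bi1 bi]) auto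
    ultimately show "(\<integral>w. sin (s * Z w) * indicator B (U w) \<partial>P) = 0" by simp
  qed
  have prod: "(\<integral>w. indicator B (U w) * indicator D (Z w) \<partial>P) =
      (\<integral>w. indicator B (U w) \<partial>P) * (\<integral>w. indicator D (Z w) \<partial>P :: real)"
    if B[measurable]: "B \<in> sets borel" and D[measurable]: "D \<in> sets borel" for B D
  proof -
    define p where "p = (\<integral>w. indicator B (U w) \<partial>P :: real)"
    have bi: "integrable P (\<lambda>w. indicator B (U w) :: real)"
      by (rule P.integrable_const_bound[where B=1]) (auto simp: indicator_def)
    show ?thesis
    proof (cases "p = 0")
      case True
      then have "AE w in P. indicator B (U w) = (0::real)"
        unfolding p_def by (subst (asm) integral_nonneg_eq_0_iff_AE) (auto intro!: bi)
      then have "(\<integral>w. indicator B (U w) * indicator D (Z w) \<partial>P) = (\<integral>w. 0 \<partial>P :: real)"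
        by (intro integral_cong_AE) auto
      then show ?thesis using True p_def by simp
    next
      case False
      then have p: "p > 0" unfolding p_def by (simp add: order_less_le)
      have "(\<integral>w. (indicator B (U w) / p) * indicator D (Z w) \<partial>P) = (\<integral>w. indicator D (Z w) \<partial>P)"
      proof (rule integral_tilt_eq[OF P Z _ _ _ _ D])
        show "integrable P (\<lambda>w. indicator B (U w) / p)" using bi by simp
        show "0 \<le> indicator B (U w) / p" for w using p by simp
        fix s
        have bci: "integrable P (\<lambda>w. complex_of_real (h w * indicator B (U w)))"
          if [measurable]: "h \<in> borel_measurable P" and "\<And>w. \<bar>h w\<bar> \<le> 1" for h :: "'w \<Rightarrow> real"
          by (rule P.integrable_const_bound[where B=1]) (use that in \<open>auto simp: indicator_def\<close>)
        have "(CLINT w|P. (indicator B (U w) / p) *\<^sub>R iexp (s * Z w)) =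
          (CLINT w|P. (complex_of_real (cos (s * Z w) * indicator B (U w)) + \<i> * complex_of_real (sin (s * Z w) * indicator B (U w))) / p)"
          by (rule Bochner_Integration.integral_cong) (auto simp: complex_eq_iff Re_exp Im_exp)
        also have "\<dots> = (complex_of_real (\<integral>w. cos (s * Z w) * indicator B (U w) \<partial>P) + \<i> * complex_of_real (\<integral>w. sin (s * Z w) * indicator B (U w) \<partial>P)) / p"
          by (simp only: integral_divide_zero)
            (subst Bochner_Integration.integral_add, auto intro!: bci integrable_mult_right simp del: of_real_mult)
        also have "\<dots> = complex_of_real (exp (- (s\<^sup>2 * vZ) / 2))"
          unfolding cosB[OF B] sinB[OF B] using p by (simp add: p_def)
        also have "\<dots> = (CLINT w|P. iexp (s * Z w))" using ch[of s 0] P.prob_space by simp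
        finally show "(CLINT w|P. (indicator B (U w) / p) *\<^sub>R iexp (s * Z w)) = (CLINT w|P. iexp (s * Z w))" .
      qed auto
      then have "(\<integral>w. indicator B (U w) * indicator D (Z w) / p \<partial>P) = (\<integral>w. indicator D (Z w) \<partial>P)"
        by simp
      then show ?thesis unfolding integral_divide_zero p_def[symmetric] using p by (simp add: field_simps)
    qed
  qed
  interpret LZ: prob_space "distr P borel Z" by (rule P.prob_space_distr) simp
  interpret LU: prob_space "distr P borel U" by (rule P.prob_space_distr) simp
  show ?thesis
  proof (rule pair_measure_eqI[symmetric])
    fix D B assume "D \<in> sets (distr P borel Z)" "B \<in> sets (distr P borel U)"
    then have [measurable]: "D \<in> sets borel" "B \<in> sets borel" by auto
    have e: "emeasure (distr P borel f) C = ennreal (\<integral>w. indicator C (f w) \<partial>P)"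
      if [measurable]: "f \<in> borel_measurable P" "C \<in> sets borel" for f :: "'w \<Rightarrow> real" and C
    proof -
      have "(\<integral>w. indicator C (f w) \<partial>P) = (\<integral>x. indicator C x \<partial>distr P borel f :: real)"
        by (subst integral_distr) auto
      also have "\<dots> = measure (distr P borel f) C" by simp
      finally show ?thesis using P.prob_space_distr[of f borel]
        by (simp add: finite_measure.emeasure_eq_measure prob_space.finite_measure)
    qed
    have "emeasure (distr P (borel \<Otimes>\<^sub>M borel) (\<lambda>w. (Z w, U w))) (D \<times> B) =
      ennreal (\<integral>w. indicator (D \<times> B) (Z w, U w) \<partial>P)"
    proof -
      have "(\<integral>w. indicator (D \<times> B) (Z w, U w) \<partial>P) = (\<integral>x. indicator (D \<times> B) x \<partial>distr P (borel \<Otimes>\<^sub>M borel) (\<lambda>w. (Z w, U w)) :: real)"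
        by (subst integral_distr) auto
      also have "\<dots> = measure (distr P (borel \<Otimes>\<^sub>M borel) (\<lambda>w. (Z w, U w))) (D \<times> B)" by simp
      finally show ?thesis using P.prob_space_distr[of "\<lambda>w. (Z w, U w)" "borel \<Otimes>\<^sub>M borel"]
        by (simp add: finite_measure.emeasure_eq_measure prob_space.finite_measure)
    qed
    also have "(\<integral>w. indicator (D \<times> B) (Z w, U w) \<partial>P) = (\<integral>w. indicator B (U w) * indicator D (Z w) \<partial>P :: real)"
      by (rule Bochner_Integration.integral_cong) (auto simp: indicator_def)
    finally show "emeasure (distr P borel Z) D * emeasure (distr P borel U) B =
        emeasure (distr P (borel \<Otimes>\<^sub>M borel) (\<lambda>w. (Z w, U w))) (D \<times> B)"
      by (simp add: e prod ennreal_mult[symmetric] mult.commute)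
  qed (auto simp: LZ.sigma_finite_measure_axioms LU.sigma_finite_measure_axioms cong: sets_pair_measure_cong)
qed

text \<open>Subtracting the least squares line in \<open>U\<close> leaves a residual uncorrelated
  with \<open>U\<close>. Under joint Gaussianity it is then independent of \<open>U\<close>, so the
  law of \<open>A\<close> given \<open>U = u\<close> is the residual law translated to the line.
  This is why the conditional variance does not depend on \<open>u\<close>.\<close>

lemma gaussian_regression:
  fixes A U :: "'w \<Rightarrow> real"
  assumes P: "prob_space P" and A[measurable]: "A \<in> borel_measurable P" and U[measurable]: "U \<in> borel_measurable P"
    and G: "\<And>a b. gaussian_law (distr P borel (\<lambda>w. a * A w + b * U w))"
  obtains b c where
    "gaussian_law (distr P borel (\<lambda>w. A w - (b * U w + c)))"
    "(\<integral>w. A w - (b * U w + c) \<partial>P) = 0"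
    "(\<integral>w. (A w - (b * U w + c))\<^sup>2 \<partial>P) \<le> (\<integral>w. (A w - (\<integral>w. A w \<partial>P))\<^sup>2 \<partial>P)"
    "is_cond_distr P borel borel A U
      (\<lambda>u. distr (distr P borel (\<lambda>w. A w - (b * U w + c))) borel (\<lambda>z. z + (b * u + c)))"
proof -
  interpret P: prob_space P by fact
  have sq: "integrable P (\<lambda>w. (a * A w + b * U w)\<^sup>2)" for a b
    using gaussian_lawD(2)[OF G[of a b]] by (subst (asm) integrable_distr_eq) auto
  have A2: "integrable P (\<lambda>w. (A w)\<^sup>2)" and U2: "integrable P (\<lambda>w. (U w)\<^sup>2)"
    using sq[of 1 0] sq[of 0 1] by simp_all
  have Ai: "integrable P A" and Ui: "integrable P U"
    using P.square_integrable_imp_integrable[OF A A2] P.square_integrable_imp_integrable[OF U U2] by auto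
  define mA where "mA = (\<integral>w. A w \<partial>P)"
  define mU where "mU = (\<integral>w. U w \<partial>P)"
  define A' where "A' w = A w - mA" for w
  define U' where "U' w = U w - mU" for w
  have A'[measurable]: "A' \<in> borel_measurable P" and U'[measurable]: "U' \<in> borel_measurable P"
    unfolding A'_def[abs_def] U'_def[abs_def] by measurable
  have iA': "integrable P A'" "(\<integral>w. A' w \<partial>P) = 0" and iU': "integrable P U'" "(\<integral>w. U' w \<partial>P) = 0"
    unfolding A'_def[abs_def] U'_def[abs_def] using Ai Ui P.prob_space by (auto simp: mA_def mU_def)
  have A'2: "integrable P (\<lambda>w. (A' w)\<^sup>2)" and U'2: "integrable P (\<lambda>w. (U' w)\<^sup>2)"
    unfolding A'_def U'_def power2_diff
    using A2 U2 Ai Ui by (auto intro!: Bochner_Integration.integrable_diff Bochner_Integration.integrable_add)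
  have AU: "integrable P (\<lambda>w. A' w * U' w)" by (rule integrable_mult_of_squares[OF A' U' A'2 U'2])
  define vU where "vU = (\<integral>w. (U' w)\<^sup>2 \<partial>P)"
  define b where "b = (\<integral>w. A' w * U' w \<partial>P) / vU"
  define c where "c = mA - b * mU"
  define Z where "Z w = A w - (b * U w + c)" for w
  have Z[measurable]: "Z \<in> borel_measurable P" unfolding Z_def[abs_def] by measurable
  have ZA: "Z w = A' w - b * U' w" for w by (simp add: Z_def A'_def U'_def c_def algebra_simps)
  have Z0: "(\<integral>w. Z w \<partial>P) = 0" unfolding ZA using iA' iU' by simp
  have Zi: "integrable P Z" unfolding ZA[abs_def] using iA' iU' by simp
  \<comment> \<open>A constant \<open>U\<close> is allowed. Then \<open>vU = 0\<close> and division
    by zero sets \<open>b = 0\<close>, but the identity survives because the covariance vanishes as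
    well.\<close>
  have covb: "(\<integral>w. A' w * U' w \<partial>P) = b * vU"
  proof (cases "vU = 0")
    case True
    then have "AE w in P. (U' w)\<^sup>2 = 0"
      unfolding vU_def by (subst (asm) integral_nonneg_eq_0_iff_AE) (auto intro!: U'2)
    then have "AE w in P. A' w * U' w = 0" by eventually_elim simp
    then have "(\<integral>w. A' w * U' w \<partial>P) = (\<integral>w. 0 \<partial>P)" by (intro integral_cong_AE) auto
    then show ?thesis using True by simp
  qed (simp add: b_def)
  have ZU': "integrable P (\<lambda>w. Z w * U' w)" "(\<integral>w. Z w * U' w \<partial>P) = 0"
  proof -
    have e: "Z w * U' w = A' w * U' w - b * (U' w)\<^sup>2" for w
      by (simp add: ZA power2_eq_square algebra_simps)
    show "integrable P (\<lambda>w. Z w * U' w)" "(\<integral>w. Z w * U' w \<partial>P) = 0"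
      unfolding e using AU U'2 covb by (auto simp: vU_def)
  qed
  have ZU: "(\<integral>w. Z w * U w \<partial>P) = 0"
  proof -
    have "(\<integral>w. Z w * U w \<partial>P) = (\<integral>w. Z w * U' w + mU * Z w \<partial>P)"
      by (rule Bochner_Integration.integral_cong) (auto simp: U'_def algebra_simps)
    also have "\<dots> = 0" using ZU' Zi Z0 by simp
    finally show ?thesis .
  qed
  have GZ: "gaussian_law (distr P borel (\<lambda>w. a * Z w + d * U w))" for a d
  proof -
    have "distr P borel (\<lambda>w. a * Z w + d * U w) =
        distr (distr P borel (\<lambda>w. a * A w + (d - a * b) * U w)) borel (\<lambda>x. x + (- a * c))"
      by (subst distr_distr) (auto simp: comp_def Z_def algebra_simps intro!: distr_cong)
    then show ?thesis using gaussian_law_shift[OF G] by metis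
  qed
  have "distr P borel Z = distr P borel (\<lambda>w. 1 * Z w + 0 * U w)" by simp
  then have GZ1: "gaussian_law (distr P borel Z)" using GZ by metis
  let ?L = "distr P borel Z" and ?b = "borel :: real measure"
  have indep: "distr P (borel \<Otimes>\<^sub>M borel) (\<lambda>w. (Z w, U w)) = ?L \<Otimes>\<^sub>M distr P borel U"
    by (rule distr_pair_eq_product_of_uncorrelated_gaussian[OF P Z U GZ Z0 ZU])
  let ?W = "\<lambda>u. distr ?L borel (\<lambda>z. z + (b * u + c))"
  interpret L: prob_space ?L by (rule P.prob_space_distr) simp
  interpret LU: prob_space "distr P borel U" by (rule P.prob_space_distr) simp
  have Lsp: "?L \<in> space (prob_algebra borel)" using L.prob_space_axioms by (simp add: space_prob_algebra)
  have W[measurable]: "?W \<in> borel \<rightarrow>\<^sub>M prob_algebra borel"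
    by (rule measurable_distr_prob_space2[where M=borel]) (use Lsp in \<open>auto intro!: measurable_const\<close>)
  have K: "(\<lambda>u. distr (?W u) (?b \<Otimes>\<^sub>M ?b) (\<lambda>x. (x, u))) \<in> borel \<rightarrow>\<^sub>M prob_algebra (?b \<Otimes>\<^sub>M ?b)"
    by measurable
  have LUsp: "distr P borel U \<in> space (prob_algebra borel)"
    using LU.prob_space_axioms by (simp add: space_prob_algebra)
  interpret LL: pair_sigma_finite ?L "distr P borel U"
    by (intro pair_sigma_finite.intro L.sigma_finite_measure_axioms LU.sigma_finite_measure_axioms)
  have "distr P (?b \<Otimes>\<^sub>M ?b) (\<lambda>w. (A w, U w)) =
      distr P borel U \<bind> (\<lambda>u. distr (?W u) (?b \<Otimes>\<^sub>M ?b) (\<lambda>x. (x, u)))"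
  proof (rule measure_eqI)
    fix C assume "C \<in> sets (distr P (?b \<Otimes>\<^sub>M ?b) (\<lambda>w. (A w, U w)))"
    then have C[measurable]: "C \<in> sets (?b \<Otimes>\<^sub>M ?b)" by simp
    let ?f = "\<lambda>(z, u). indicator C (z + (b * u + c), u) :: ennreal"
    have f: "?f \<in> borel_measurable (?b \<Otimes>\<^sub>M ?b)" by measurable
    have "emeasure (distr P (?b \<Otimes>\<^sub>M ?b) (\<lambda>w. (A w, U w))) C = (\<integral>\<^sup>+w. indicator C (A w, U w) \<partial>P)"
      by (subst nn_integral_indicator[symmetric], simp, subst nn_integral_distr) auto
    also have "\<dots> = (\<integral>\<^sup>+w. ?f (Z w, U w) \<partial>P)"
      by (simp add: Z_def)
    also have "\<dots> = (\<integral>\<^sup>+p. ?f p \<partial>distr P (?b \<Otimes>\<^sub>M ?b) (\<lambda>w. (Z w, U w)))"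
      using f by (subst nn_integral_distr) auto
    also have "\<dots> = (\<integral>\<^sup>+u. \<integral>\<^sup>+z. ?f (z, u) \<partial>?L \<partial>distr P borel U)"
      unfolding indep using f by (subst LL.nn_integral_snd[symmetric]) (auto cong: measurable_cong_sets sets_pair_measure_cong)
    also have "\<dots> = (\<integral>\<^sup>+u. emeasure (distr (?W u) (?b \<Otimes>\<^sub>M ?b) (\<lambda>x. (x, u))) C \<partial>distr P borel U)"
    proof (rule nn_integral_cong)
      fix u
      have "(\<integral>\<^sup>+z. ?f (z, u) \<partial>?L) = (\<integral>\<^sup>+x. indicator C (x, u) \<partial>?W u)"
        by (subst nn_integral_distr) auto
      also have "\<dots> = (\<integral>\<^sup>+p. indicator C p \<partial>distr (?W u) (?b \<Otimes>\<^sub>M ?b) (\<lambda>x. (x, u)))"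
        by (subst (2) nn_integral_distr) auto
      finally show "(\<integral>\<^sup>+z. ?f (z, u) \<partial>?L) = emeasure (distr (?W u) (?b \<Otimes>\<^sub>M ?b) (\<lambda>x. (x, u))) C"
        by simp
    qed
    also have "\<dots> = emeasure (distr P borel U \<bind> (\<lambda>u. distr (?W u) (?b \<Otimes>\<^sub>M ?b) (\<lambda>x. (x, u)))) C"
      by (rule emeasure_bind_prob_algebra[OF LUsp K C, symmetric])
    finally show "emeasure (distr P (?b \<Otimes>\<^sub>M ?b) (\<lambda>w. (A w, U w))) C =
        emeasure (distr P borel U \<bind> (\<lambda>u. distr (?W u) (?b \<Otimes>\<^sub>M ?b) (\<lambda>x. (x, u)))) C" .
  qed (simp add: sets_bind'[OF LUsp K])
  then have cd: "is_cond_distr P borel borel A U ?W" using W by (simp add: is_cond_distr_def)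
  have var: "(\<integral>w. (Z w)\<^sup>2 \<partial>P) \<le> (\<integral>w. (A w - mA)\<^sup>2 \<partial>P)"
  proof -
    have Zi2: "integrable P (\<lambda>w. (Z w)\<^sup>2)"
      using gaussian_lawD(2)[OF GZ1] by (subst (asm) integrable_distr_eq) auto
    \<comment> \<open>Pythagoras: the residual and \<open>b * U'\<close> are orthogonal, so removing
      the regression part can only decrease the variance.\<close>
    have "(\<integral>w. (A w - mA)\<^sup>2 \<partial>P) = (\<integral>w. (Z w)\<^sup>2 + b\<^sup>2 * (U' w)\<^sup>2 + 2 * b * (Z w * U' w) \<partial>P)"
      unfolding A'_def[symmetric]
      by (rule Bochner_Integration.integral_cong) (auto simp: ZA power2_eq_square algebra_simps)
    also have "\<dots> = (\<integral>w. (Z w)\<^sup>2 \<partial>P) + b\<^sup>2 * vU"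
      using Zi2 U'2 ZU' by (simp add: vU_def)
    finally show ?thesis by (simp add: vU_def)
  qed
  show ?thesis
    by (rule that[of b c]) (use GZ1 Z0 cd var in \<open>simp_all add: Z_def[abs_def] mA_def\<close>)
qed

lemma gaussian_centered_density:
  assumes N: "gaussian_law N" and m: "(\<integral>x. x \<partial>N) = 0" and v: "(\<integral>x. x\<^sup>2 \<partial>N) = s\<^sup>2" and s: "s > 0"
  shows "N = density lborel (\<lambda>x. ennreal (normal_density 0 s x))"
  using N unfolding gaussian_law_def
proof (elim disjE exE conjE)
  fix a assume Na: "N = return borel a"
  have "(\<integral>x. x\<^sup>2 \<partial>N) = a\<^sup>2" "(\<integral>x. x \<partial>N) = a" unfolding Na by (subst integral_return; simp)+
  then show ?thesis using m v s by simp
next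
  fix a r :: real assume r: "0 < r" and Na: "N = density lborel (\<lambda>x. ennreal (normal_density a r x))"
  have "a = 0" using normal_distribution_moments(2)[OF r, of a] m Na by simp
  then have "r\<^sup>2 = s\<^sup>2" using normal_distribution_moments(3)[OF r, of a] v Na by simp
  then have "r = s" using r s by (simp add: power2_eq_iff)
  then show ?thesis using Na \<open>a = 0\<close> by simp
qed

text \<open>
  The test function \<open>g\<close> is the ratio of the Gaussian test channel \<open>X|Y \<sim> N(Y, v/4)\<close> to the true
  conditional law \<open>X|U \<sim> N(m U, v)\<close>; it integrates to one under \<open>P\<^sub>U P\<^sub>X\<^sub>|\<^sub>U P\<^sub>Y\<^sub>|\<^sub>U\<close> for any
  conditional law of \<open>Y\<close>.
\<close>

lemma residual_variance_le_of_cond_mutual_info: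
  fixes X Y U :: "'w \<Rightarrow> real"
  assumes P: "prob_space P" and [measurable]: "X \<in> borel_measurable P" "Y \<in> borel_measurable P" "U \<in> borel_measurable P"
    and GX: "gaussian_law (distr P borel (\<lambda>w. X w - (b * U w + c)))"
    and Z0: "(\<integral>w. X w - (b * U w + c) \<partial>P) = 0"
    and cX: "is_cond_distr P borel borel X U
      (\<lambda>u. distr (distr P borel (\<lambda>w. X w - (b * U w + c))) borel (\<lambda>z. z + (b * u + c)))"
    and cY: "is_cond_distr P borel borel Y U V"
    and XY2: "integrable P (\<lambda>w. (X w - Y w)\<^sup>2)"
    and I: "cond_mutual_info P X Y U \<le> 1"
  shows "(\<integral>w. (X w - (b * U w + c))\<^sup>2 \<partial>P) \<le> 4 * (\<integral>w. (X w - Y w)\<^sup>2 \<partial>P)"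
proof (cases "(\<integral>w. (X w - (b * U w + c))\<^sup>2 \<partial>P) = 0")
  case True
  then show ?thesis by simp
next
  case False
  interpret P: prob_space P by fact
  define m where "m u = b * u + c" for u
  have m[measurable]: "m \<in> borel_measurable borel" unfolding m_def[abs_def] by measurable
  let ?b = "borel :: real measure"
  let ?N = "?b \<Otimes>\<^sub>M ?b \<Otimes>\<^sub>M ?b"
  let ?L = "distr P borel (\<lambda>w. X w - m (U w))"
  let ?W = "\<lambda>u. distr ?L borel (\<lambda>z. z + m u)"
  define v where "v = (\<integral>w. (X w - m (U w))\<^sup>2 \<partial>P)"
  define s where "s = sqrt v"
  have "v \<ge> 0" unfolding v_def by simp
  moreover have "v \<noteq> 0" using False unfolding v_def m_def .
  ultimately have v: "v > 0" by simp
  then have s: "s > 0" and s2: "s\<^sup>2 = v" unfolding s_def by auto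
  note GX = GX[folded m_def] note Z0 = Z0[folded m_def] note cX = cX[folded m_def]
  have Z2: "integrable P (\<lambda>w. (X w - m (U w))\<^sup>2)"
    using gaussian_lawD(2)[OF GX] by (subst (asm) integrable_distr_eq) auto
  have L: "?L = density lborel (\<lambda>x. ennreal (normal_density 0 s x))"
  proof (rule gaussian_centered_density[OF GX _ _ s])
    show "(\<integral>x. x \<partial>?L) = 0" using Z0 by (subst integral_distr) auto
    show "(\<integral>x. x\<^sup>2 \<partial>?L) = s\<^sup>2" unfolding s2 v_def by (subst integral_distr) auto
  qed
  have Wd: "?W u = density lborel (\<lambda>x. ennreal (normal_density (m u) s x))" for u
    unfolding L normal_density_eq_distr_std[OF s]
    by (subst distr_distr) (auto simp: comp_def add.commute)
  \<comment> \<open>The spread \<open>s / 2\<close> is the distortion that one bit allows for a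
    Gaussian of variance \<open>v\<close>. With it the constant term of \<open>log 2 g\<close> is
    exactly 1 and cancels against the rate bound, which leaves \<open>1 / 2\<close> minus twice the
    mean squared error over \<open>v\<close>, a quantity that must be at most zero.\<close>
  define g where "g = (\<lambda>(x, y, u). normal_density y (s / 2) x / normal_density (m u) s x)"
  have g[measurable]: "g \<in> borel_measurable ?N"
    unfolding g_def normal_density_def by measurable
  have g0: "g p > 0" for p
    using s by (cases p) (simp add: g_def normal_density_pos)
  have logg: "log 2 (g (x, y, u)) = 1 + ((x - m u)\<^sup>2 / (2 * v) - 2 * (x - y)\<^sup>2 / v) / ln 2" for x y u
  proof -
    have nd: "ln (normal_density a r x) = - ln (sqrt (2 * pi * r\<^sup>2)) - (x - a)\<^sup>2 / (2 * r\<^sup>2)" if "r > 0" for a r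
      using that by (simp add: normal_density_def ln_mult ln_div)
    have q: "sqrt (2 * pi * s\<^sup>2) = 2 * sqrt (2 * pi * (s / 2)\<^sup>2)"
    proof -
      have "2 * pi * s\<^sup>2 = 2\<^sup>2 * (2 * pi * (s / 2)\<^sup>2)" by (simp add: power_divide)
      then show ?thesis by (simp only: real_sqrt_mult[of "2\<^sup>2"]) simp
    qed
    have "ln (g (x, y, u)) = ln 2 - (x - y)\<^sup>2 / (2 * (s / 2)\<^sup>2) + (x - m u)\<^sup>2 / (2 * s\<^sup>2)"
    proof -
      have p: "normal_density y (s / 2) x > 0" "normal_density (m u) s x > 0"
        using s by (auto intro: normal_density_pos)
      have "ln (g (x, y, u)) = ln (normal_density y (s / 2) x) - ln (normal_density (m u) s x)"
        unfolding g_def prod.case using p by (rule ln_divide_pos)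
      also have "ln (normal_density y (s / 2) x) = - ln (sqrt (2 * pi * (s / 2)\<^sup>2)) - (x - y)\<^sup>2 / (2 * (s / 2)\<^sup>2)"
        using s by (intro nd) simp
      also have "ln (normal_density (m u) s x) = - ln (sqrt (2 * pi * s\<^sup>2)) - (x - m u)\<^sup>2 / (2 * s\<^sup>2)"
        using s by (intro nd) simp
      also have "ln (sqrt (2 * pi * s\<^sup>2)) = ln 2 + ln (sqrt (2 * pi * (s / 2)\<^sup>2))"
        unfolding q using s by (intro ln_mult_pos) auto
      finally show ?thesis by simp
    qed
    also have "\<dots> = ln 2 + ((x - m u)\<^sup>2 / (2 * v) - 2 * (x - y)\<^sup>2 / v)"
      by (simp add: s2 power_divide)
    finally show ?thesis by (simp add: log_def add_divide_distrib)
  qed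
  have Wm[measurable]: "?W \<in> borel \<rightarrow>\<^sub>M prob_algebra borel" "V \<in> borel \<rightarrow>\<^sub>M prob_algebra borel"
    using cX cY by (auto simp: is_cond_distr_def)
  let ?k = "\<lambda>u. distr (?W u \<Otimes>\<^sub>M V u) ?N (\<lambda>(x, y). (x, y, u))"
  have k[measurable]: "?k \<in> borel \<rightarrow>\<^sub>M prob_algebra ?N" by measurable
  have LU: "distr P borel U \<in> space (prob_algebra borel)"
    by (simp add: space_prob_algebra P.prob_space_distr)
  have Q: "cond_indep_law P X Y U = distr P borel U \<bind> ?k"
    by (rule cond_indep_law_eq[OF P _ _ _ cX cY]) auto
  have setsQ: "sets (cond_indep_law P X Y U) = sets ?N"
    unfolding Q by (rule sets_bind'[OF LU k])
  have Vu: "prob_space (V u)" "sets (V u) = sets borel" for u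
    using measurable_space[OF Wm(2), of u] by (auto simp: space_prob_algebra)
  have Wu: "prob_space (?W u)" for u
    using measurable_space[OF Wm(1), of u] by (auto simp: space_prob_algebra)
  let ?D = "distr P ?N (\<lambda>w. (X w, Y w, U w))"
  have "(\<integral>p. log 2 (g p) \<partial>?D) \<le> 1"
  proof (rule integral_log_le_of_KL_ext_le)
    show "prob_space (cond_indep_law P X Y U)" unfolding Q by (rule prob_space_bind'[OF LU k])
    show "prob_space ?D" by (intro P.prob_space_distr) auto
    show "sets ?D = sets (cond_indep_law P X Y U)" using setsQ by simp
    show "g \<in> borel_measurable (cond_indep_law P X Y U)"
      using g setsQ by (simp cong: measurable_cong_sets)
    show "KL_ext (cond_indep_law P X Y U) ?D \<le> ereal 1"
      using I unfolding cond_mutual_info_def by (simp add: one_ereal_def)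
    show "integrable ?D (\<lambda>p. log 2 (g p))"
    proof (subst integrable_distr_eq)
      show "integrable P (\<lambda>w. log 2 (g (X w, Y w, U w)))"
        unfolding logg using Z2 XY2
        by (intro Bochner_Integration.integrable_add P.integrable_const integrable_divide
            Bochner_Integration.integrable_diff integrable_mult_right)
    qed auto
    have "(\<integral>\<^sup>+p. ennreal (g p) \<partial>cond_indep_law P X Y U)
        = (\<integral>\<^sup>+u. \<integral>\<^sup>+p. ennreal (g p) \<partial>?k u \<partial>distr P borel U)"
      unfolding Q by (rule nn_integral_bind) (auto intro!: measurable_prob_algebraD k)
    also have "\<dots> = (\<integral>\<^sup>+u. 1 \<partial>distr P borel U)"
    proof (rule nn_integral_cong)
      fix u
      interpret Wu: prob_space "?W u" by (rule Wu)
      interpret Vu: prob_space "V u" by (rule Vu)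
      interpret WV: pair_sigma_finite "?W u" "V u"
        by (intro pair_sigma_finite.intro Wu.sigma_finite_measure_axioms Vu.sigma_finite_measure_axioms)
      have sWV: "sets (?W u \<Otimes>\<^sub>M V u) = sets (?b \<Otimes>\<^sub>M ?b)"
        using Vu by (intro sets_pair_measure_cong) auto
      have me: "(\<lambda>(x, y). (x, y, u)) \<in> ?W u \<Otimes>\<^sub>M V u \<rightarrow>\<^sub>M ?N"
        using sWV by (simp cong: measurable_cong_sets)
      have mg: "(\<lambda>p. ennreal (g ((\<lambda>(x, y). (x, y, u)) p))) \<in> borel_measurable (?W u \<Otimes>\<^sub>M V u)"
        using measurable_compose[OF me g] by measurable
      have "(\<integral>\<^sup>+p. ennreal (g p) \<partial>?k u) = (\<integral>\<^sup>+p. ennreal (g ((\<lambda>(x, y). (x, y, u)) p)) \<partial>(?W u \<Otimes>\<^sub>M V u))"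
        by (rule nn_integral_distr[OF me]) measurable
      \<comment> \<open>The order of integration matters: integrating over \<open>x\<close> first,
        with \<open>y\<close> fixed, cancels the denominator of \<open>g\<close> against the density
        of \<open>?W u\<close> and leaves a normal density of total mass one.\<close>
      also have "\<dots> = (\<integral>\<^sup>+y. \<integral>\<^sup>+x. ennreal (g (x, y, u)) \<partial>?W u \<partial>V u)"
        by (subst WV.nn_integral_snd[OF mg, symmetric]) simp
      also have "\<dots> = (\<integral>\<^sup>+y. 1 \<partial>V u)"
      proof (rule nn_integral_cong)
        fix y
        have "(\<integral>\<^sup>+x. ennreal (g (x, y, u)) \<partial>?W u)
            = (\<integral>\<^sup>+x. ennreal (normal_density (m u) s x) * ennreal (g (x, y, u)) \<partial>lborel)"
          unfolding Wd by (rule nn_integral_density) measurable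
        also have "\<dots> = (\<integral>\<^sup>+x. ennreal (normal_density y (s / 2) x) \<partial>lborel)"
        proof (rule nn_integral_cong)
          fix x
          have "normal_density (m u) s x > 0" using s by (rule normal_density_pos)
          then show "ennreal (normal_density (m u) s x) * ennreal (g (x, y, u)) = ennreal (normal_density y (s / 2) x)"
            by (subst ennreal_mult[symmetric]) (auto simp: g_def)
        qed
        also have "\<dots> = 1"
          using s by (subst nn_integral_eq_integral) auto
        finally show "(\<integral>\<^sup>+x. ennreal (g (x, y, u)) \<partial>?W u) = 1" .
      qed
      also have "\<dots> = 1" using Vu.emeasure_space_1 by simp
      finally show "(\<integral>\<^sup>+p. ennreal (g p) \<partial>?k u) = 1" .
    qed
    also have "\<dots> = 1"
      using prob_space.emeasure_space_1[OF P.prob_space_distr[of U borel]] by simp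
    finally show "(\<integral>\<^sup>+p. ennreal (g p) \<partial>cond_indep_law P X Y U) \<le> 1" by simp
  qed (rule g0)
  also have "(\<integral>p. log 2 (g p) \<partial>?D) = (\<integral>w. log 2 (g (X w, Y w, U w)) \<partial>P)"
    by (rule integral_distr) measurable
  also have "\<dots> = (\<integral>w. 1 + ((X w - m (U w))\<^sup>2 / (2 * v) - 2 * (X w - Y w)\<^sup>2 / v) / ln 2 \<partial>P)"
    unfolding logg ..
  also have "\<dots> = 1 + (v / (2 * v) - 2 * (\<integral>w. (X w - Y w)\<^sup>2 \<partial>P) / v) / ln 2"
    using Z2 XY2 P.prob_space by (simp add: v_def[symmetric])
  finally have "1 / 2 - 2 * (\<integral>w. (X w - Y w)\<^sup>2 \<partial>P) / v \<le> 0"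
    using v by (simp add: divide_le_0_iff)
  then have "v \<le> 4 * (\<integral>w. (X w - Y w)\<^sup>2 \<partial>P)"
    using v by (simp add: field_simps)
  then show ?thesis by (simp add: v_def m_def)
qed

section \<open>The Gaussian upper bound\<close>

lemma ext_expectation_eq_integral:
  assumes "integrable P f"
  shows "ext_expectation P f = ereal (\<integral>w. f w \<partial>P)"
proof -
  have fin: "(\<integral>\<^sup>+w. ennreal (f w) \<partial>P) < \<infinity>" "(\<integral>\<^sup>+w. ennreal (- f w) \<partial>P) < \<infinity>"
    using assms by (auto simp: real_integrable_def less_top[symmetric])
  then obtain a b where ab: "(\<integral>\<^sup>+w. ennreal (f w) \<partial>P) = ennreal a" "a \<ge> 0"
     "(\<integral>\<^sup>+w. ennreal (- f w) \<partial>P) = ennreal b" "b \<ge> 0"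
    by (metis ennreal_cases infinity_ennreal_def less_irrefl)
  then show ?thesis
    unfolding ext_expectation_def real_lebesgue_integral_def[OF assms] by (simp add: enn2ereal_ennreal)
qed

text \<open>The marginal identity is how the variance of the source enters the Gaussian
  bound.\<close>

lemma joint_law_space:
  assumes "\<sigma> > 0" "\<kappa> \<in> channels"
  shows "joint_law \<mu> \<sigma> \<kappa> \<in> space (prob_algebra (borel \<Otimes>\<^sub>M borel \<Otimes>\<^sub>M borel))"
    and "distr (joint_law \<mu> \<sigma> \<kappa>) borel Xv = source \<mu> \<sigma>"
proof -
  let ?b = "borel :: real measure"
  let ?N = "?b \<Otimes>\<^sub>M ?b \<Otimes>\<^sub>M ?b"
  have [measurable]: "\<kappa> \<in> borel \<rightarrow>\<^sub>M prob_algebra (?b \<Otimes>\<^sub>M ?b)"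
    using assms by (simp add: channels_def)
  let ?K = "\<lambda>x. distr (\<kappa> x) ?N (\<lambda>(y, u). (x, y, u))"
  have K[measurable]: "?K \<in> borel \<rightarrow>\<^sub>M prob_algebra ?N" by measurable
  have S: "source \<mu> \<sigma> \<in> space (prob_algebra borel)"
    using prob_space_normal_density[OF assms(1), of \<mu>] by (simp add: source_def space_prob_algebra)
  show "joint_law \<mu> \<sigma> \<kappa> \<in> space (prob_algebra ?N)"
    unfolding joint_law_def
    using prob_space_bind'[OF S K] sets_bind'[OF S K] by (simp add: space_prob_algebra)
  have sK: "prob_space (\<kappa> x)" "sets (\<kappa> x) = sets (?b \<Otimes>\<^sub>M ?b)" for x
    using measurable_space[of \<kappa> borel "prob_algebra (?b \<Otimes>\<^sub>M ?b)" x] by (auto simp: space_prob_algebra)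
  have sS: "sets (source \<mu> \<sigma>) = sets borel" "space (source \<mu> \<sigma>) \<noteq> {}" by (auto simp: source_def)
  have "distr (joint_law \<mu> \<sigma> \<kappa>) borel Xv = source \<mu> \<sigma> \<bind> (\<lambda>x. distr (?K x) borel Xv)"
    unfolding joint_law_def
    by (rule distr_bind[where K="?N"])
       (use sS in \<open>auto intro!: measurable_prob_algebraD cong: measurable_cong_sets\<close>)
  also have "\<dots> = source \<mu> \<sigma> \<bind> (\<lambda>x. return borel x)"
  proof (rule bind_cong[OF refl])
    fix x
    interpret k: prob_space "\<kappa> x" by (rule sK)
    have mx: "(\<lambda>(y, u). (x, y, u)) \<in> \<kappa> x \<rightarrow>\<^sub>M ?N"
      unfolding measurable_cong_sets[OF sK(2)[of x] refl] by measurable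
    have "distr (?K x) borel Xv = distr (\<kappa> x) borel (\<lambda>_. x)"
      by (subst distr_distr[OF _ mx]) (auto simp: comp_def case_prod_beta)
    also have "\<dots> = return borel x"
      by (rule measure_eqI) (auto simp: emeasure_distr k.emeasure_space_1 split: split_indicator)
    finally show "distr (?K x) borel Xv = return borel x" .
  qed
  also have "\<dots> = source \<mu> \<sigma>" using sS(1) by (intro bind_return'') simp
  finally show "distr (joint_law \<mu> \<sigma> \<kappa>) borel Xv = source \<mu> \<sigma>" .
qed

lemma min_payoff_jointly_gaussian_le:
  assumes s: "\<sigma> > 0" and f: "\<kappa> \<in> feasible \<mu> \<sigma> R 1" and jg: "jointly_gaussian (joint_law \<mu> \<sigma> \<kappa>)"
  shows "min_payoff \<mu> \<sigma> \<kappa> \<le> ereal (3 / 4)"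
proof -
  define P where "P = joint_law \<mu> \<sigma> \<kappa>"
  let ?b = "borel :: real measure"
  let ?N = "?b \<Otimes>\<^sub>M ?b \<Otimes>\<^sub>M ?b"
  have ch: "\<kappa> \<in> channels" and I: "cond_mutual_info P Xv Yv Uv \<le> 1"
    using f by (auto simp: feasible_def P_def one_ereal_def)
  have P: "prob_space P" and setsP: "sets P = sets ?N"
    using joint_law_space(1)[OF s ch, of \<mu>] by (auto simp: P_def space_prob_algebra)
  interpret P: prob_space P by fact
  have X: "Xv \<in> borel_measurable P" and Y: "Yv \<in> borel_measurable P" and U: "Uv \<in> borel_measurable P"
    using setsP by (simp_all cong: measurable_cong_sets)
  note [measurable] = X Y U and [measurable_cong] = setsP
  have G: "gaussian_law (distr P borel (\<lambda>w. a * Xv w + b * Yv w + c * Uv w))" for a b c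
    using jg unfolding jointly_gaussian_def P_def[symmetric] by (simp add: case_prod_beta')
  have GX: "gaussian_law (distr P borel (\<lambda>w. a * Xv w + b * Uv w))" for a b using G[of a 0 b] by simp
  have GY: "gaussian_law (distr P borel (\<lambda>w. a * Yv w + b * Uv w))" for a b using G[of 0 a b] by simp
  obtain b c where GZ: "gaussian_law (distr P borel (\<lambda>w. Xv w - (b * Uv w + c)))"
    and Z0: "(\<integral>w. Xv w - (b * Uv w + c) \<partial>P) = 0"
    and var: "(\<integral>w. (Xv w - (b * Uv w + c))\<^sup>2 \<partial>P) \<le> (\<integral>w. (Xv w - (\<integral>w. Xv w \<partial>P))\<^sup>2 \<partial>P)"
    and cX: "is_cond_distr P borel borel Xv Uv
      (\<lambda>u. distr (distr P borel (\<lambda>w. Xv w - (b * Uv w + c))) borel (\<lambda>z. z + (b * u + c)))"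
    by (rule gaussian_regression[OF P X U GX])
  \<comment> \<open>Supplies a version of the law of \<open>Y\<close> given \<open>U\<close>; the
    residual bound accepts any version.\<close>
  obtain b' c' where cY: "is_cond_distr P borel borel Yv Uv
      (\<lambda>u. distr (distr P borel (\<lambda>w. Yv w - (b' * Uv w + c'))) borel (\<lambda>z. z + (b' * u + c')))"
    by (rule gaussian_regression[OF P Y U GY])
  have XY2: "integrable P (\<lambda>w. (Xv w - Yv w)\<^sup>2)"
    using gaussian_lawD(2)[OF G[of 1 "-1" 0]] by (subst (asm) integrable_distr_eq) auto
  have Z2: "integrable P (\<lambda>w. (Xv w - (b * Uv w + c))\<^sup>2)"
    using gaussian_lawD(2)[OF GZ] by (subst (asm) integrable_distr_eq) auto
  have bound: "(\<integral>w. (Xv w - (b * Uv w + c))\<^sup>2 \<partial>P) \<le> 4 * (\<integral>w. (Xv w - Yv w)\<^sup>2 \<partial>P)"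
    by (rule residual_variance_le_of_cond_mutual_info[OF P X Y U GZ Z0 cX cY XY2 I])
  have varX: "(\<integral>w. (Xv w - (\<integral>w. Xv w \<partial>P))\<^sup>2 \<partial>P) = \<sigma>\<^sup>2"
  proof -
    have src: "distr P borel Xv = density lborel (\<lambda>x. ennreal (normal_density \<mu> \<sigma> x))"
      using joint_law_space(2)[OF s ch, of \<mu>] by (simp add: P_def source_def)
    have "(\<integral>w. Xv w \<partial>P) = (\<integral>x. x \<partial>distr P borel Xv)" by (subst integral_distr) auto
    then have m: "(\<integral>w. Xv w \<partial>P) = \<mu>" using normal_distribution_moments(2)[OF s] src by simp
    have "(\<integral>w. (Xv w - \<mu>)\<^sup>2 \<partial>P) = (\<integral>x. (x - \<mu>)\<^sup>2 \<partial>distr P borel Xv)" by (subst integral_distr) auto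
    then show ?thesis using normal_distribution_moments(3)[OF s] src m by simp
  qed
  let ?f = "\<lambda>w. payoff \<sigma> (Xv w) (Yv w) (b * Uv w + c)"
  have fe: "?f w = ((Xv w - (b * Uv w + c))\<^sup>2 - (Xv w - Yv w)\<^sup>2) / \<sigma>\<^sup>2" for w
    by (cases w) (simp add: payoff_def power2_commute)
  have "min_payoff \<mu> \<sigma> \<kappa> \<le> ext_expectation P (\<lambda>(x, y, u). payoff \<sigma> x y (b * u + c))"
    unfolding min_payoff_def P_def by (rule INF_lower) measurable
  also have "(\<lambda>(x, y, u). payoff \<sigma> x y (b * u + c)) = ?f" by (auto simp: case_prod_beta')
  also have "ext_expectation P ?f = ereal (\<integral>w. ?f w \<partial>P)"
    unfolding fe using Z2 XY2 by (intro ext_expectation_eq_integral integrable_divide Bochner_Integration.integrable_diff)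
  also have "(\<integral>w. ?f w \<partial>P) = ((\<integral>w. (Xv w - (b * Uv w + c))\<^sup>2 \<partial>P) - (\<integral>w. (Xv w - Yv w)\<^sup>2 \<partial>P)) / \<sigma>\<^sup>2"
    unfolding fe integral_divide_zero using Z2 XY2 by (subst Bochner_Integration.integral_diff) auto
  also have "\<dots> \<le> 3 / 4"
    using bound var varX s by (simp add: divide_le_eq)
  finally show ?thesis by simp
qed

section \<open>The channel that reveals the quantized magnitude\<close>

lemma mutual_info_distr:
  assumes [measurable]: "T \<in> M \<rightarrow>\<^sub>M N" "X \<in> N \<rightarrow>\<^sub>M A" "Y \<in> N \<rightarrow>\<^sub>M B"
  shows "mutual_info (distr M N T) A B X Y = mutual_info M A B (\<lambda>w. X (T w)) (\<lambda>w. Y (T w))"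
  unfolding mutual_info_def by (simp add: distr_distr comp_def)

text \<open>The predicate behind the choice in \<open>cond_distr\<close> involves only laws of the
  variables, so after pushing forward both sides choose the very same kernel. As the sign channel is
  deterministic, all its quantities can thus be computed on the real line under the source.\<close>

lemma cond_mutual_info_distr:
  assumes [measurable]: "T \<in> M \<rightarrow>\<^sub>M N" "X \<in> borel_measurable N" "Y \<in> borel_measurable N" "U \<in> borel_measurable N"
  shows "cond_mutual_info (distr M N T) X Y U =
    cond_mutual_info M (\<lambda>w. X (T w)) (\<lambda>w. Y (T w)) (\<lambda>w. U (T w))"
proof -
  have "cond_distr (distr M N T) borel borel V U = cond_distr M borel borel (\<lambda>w. V (T w)) (\<lambda>w. U (T w))"
    if [measurable]: "V \<in> borel_measurable N" for V :: "'b \<Rightarrow> real"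
    unfolding cond_distr_def is_cond_distr_def by (simp add: distr_distr comp_def)
  then show ?thesis
    unfolding cond_mutual_info_def cond_indep_law_def by (simp add: distr_distr comp_def)
qed

lemma ext_expectation_distr:
  assumes [measurable]: "T \<in> M \<rightarrow>\<^sub>M N" "f \<in> borel_measurable N"
  shows "ext_expectation (distr M N T) f = ext_expectation M (\<lambda>w. f (T w))"
  unfolding ext_expectation_def by (simp add: nn_integral_distr)

context
  fixes \<mu> \<sigma> :: real
  assumes \<sigma>: "\<sigma> > 0"
begin

text \<open>The cell width \<open>\<sigma> / 4\<close> costs at most \<open>1/16\<close> of the
  variance. Saturating at \<open>8 * \<sigma>\<close> keeps the range finite and costs at most
  \<open>3/64\<close> through the fourth moment. The total \<open>7/64\<close> is below the
  announced \<open>1/8\<close>.\<close>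

definition magnitude :: "real \<Rightarrow> real" where
  "magnitude x = \<sigma> / 4 * of_int \<lfloor>min \<bar>x - \<mu>\<bar> (8 * \<sigma>) / (\<sigma> / 4)\<rfloor>"

text \<open>In the cell of magnitude zero both signs, and \<open>sgn 0 = 0\<close>, give the same
  value \<open>\<mu>\<close>; the other cells have the two values \<open>\<mu> + u\<close> and
  \<open>\<mu> - u\<close>.\<close>

definition reconstruction :: "real \<Rightarrow> real" where
  "reconstruction x = \<mu> + sgn (x - \<mu>) * magnitude x"

definition sign_channel :: channel where
  "sign_channel x = return (borel \<Otimes>\<^sub>M borel) (reconstruction x, magnitude x)"

lemma measurable_quantizer[measurable]:
  "magnitude \<in> borel_measurable borel" "reconstruction \<in> borel_measurable borel"
  unfolding magnitude_def[abs_def] reconstruction_def[abs_def] by measurable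

lemma prob_space_source: "prob_space (source \<mu> \<sigma>)"
  unfolding source_def using \<sigma> by (rule prob_space_normal_density)

lemma sets_source[measurable_cong]: "sets (source \<mu> \<sigma>) = sets borel"
  by (simp add: source_def)

lemma space_source[simp]: "space (source \<mu> \<sigma>) = UNIV"
  by (simp add: source_def)

lemma source_reflect: "distr (source \<mu> \<sigma>) borel (\<lambda>x. 2 * \<mu> - x) = source \<mu> \<sigma>"
proof -
  interpret prob_space "source \<mu> \<sigma>" by (rule prob_space_source)
  have "distributed (source \<mu> \<sigma>) lborel (\<lambda>x. x) (\<lambda>x. ennreal (normal_density \<mu> \<sigma> x))"
    unfolding distributed_def source_def by (auto simp: distr_id2)
  from normal_density_affine[OF this \<sigma>, of "-1" "2 * \<mu>"]
  have "distributed (source \<mu> \<sigma>) lborel (\<lambda>x. 2 * \<mu> - x) (\<lambda>x. ennreal (normal_density \<mu> \<sigma> x))"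
    by simp
  then have "distr (source \<mu> \<sigma>) lborel (\<lambda>x. 2 * \<mu> - x) = source \<mu> \<sigma>"
    by (simp add: distributed_def source_def)
  then show ?thesis by (simp cong: distr_cong)
qed

lemma magnitude_reflect: "magnitude (2 * \<mu> - x) = magnitude x"
  by (simp add: magnitude_def abs_minus_commute)

lemma reconstruction_reflect: "reconstruction (2 * \<mu> - x) = 2 * \<mu> - reconstruction x"
proof -
  have "2 * \<mu> - x - \<mu> = - (x - \<mu>)" by simp
  then show ?thesis unfolding reconstruction_def magnitude_reflect
    by (simp only: sgn_minus)
qed

lemma finite_range_magnitude: "finite (range magnitude)"
proof (rule finite_subset)
  show "range magnitude \<subseteq> (\<lambda>k. \<sigma> / 4 * of_int k) ` {0..32}"
  proof
    fix v assume "v \<in> range magnitude"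
    then obtain x where v: "v = magnitude x" by auto
    let ?q = "min \<bar>x - \<mu>\<bar> (8 * \<sigma>) / (\<sigma> / 4)"
    have q: "0 \<le> ?q" "?q \<le> 32" using \<sigma> by (auto simp: divide_le_eq)
    have "\<lfloor>?q\<rfloor> \<in> {0..32}" using floor_mono[OF q(1)] floor_mono[OF q(2)] by simp
    then show "v \<in> (\<lambda>k. \<sigma> / 4 * of_int k) ` {0..32}" unfolding v magnitude_def by (rule imageI)
  qed
qed simp

lemma finite_range_reconstruction: "finite (range reconstruction)"
proof (rule finite_subset)
  show "range reconstruction \<subseteq> (\<lambda>(a, v). \<mu> + a * v) ` ({-1, 0, 1} \<times> range magnitude)"
    by (auto simp: reconstruction_def sgn_real_def image_iff)
qed (simp add: finite_range_magnitude)

text \<open>Below the cut the error is that of rounding down within a cell. Above it,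
  \<open>r > 8 * \<sigma>\<close> gives \<open>r^2 \<le> r^4 / (8 * \<sigma>)^2\<close>, so one
  polynomial bound with a known normal mean covers both cases.\<close>

lemma reconstruction_error: "(x - reconstruction x)\<^sup>2 \<le> \<sigma>\<^sup>2 / 16 + (x - \<mu>) ^ 4 / (64 * \<sigma>\<^sup>2)"
proof -
  define r where "r = \<bar>x - \<mu>\<bar>"
  have r: "r \<ge> 0" by (simp add: r_def)
  have r4: "(x - \<mu>) ^ 4 = r ^ 4" by (simp add: r_def)
  have sq: "(x - reconstruction x)\<^sup>2 \<le> (r - magnitude x)\<^sup>2"
    by (auto simp: reconstruction_def r_def sgn_real_def abs_if power2_eq_square algebra_simps)
  show ?thesis
  proof (cases "r \<le> 8 * \<sigma>")
    case True
    then have m: "magnitude x = \<sigma> / 4 * of_int \<lfloor>r / (\<sigma> / 4)\<rfloor>" by (simp add: magnitude_def r_def)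
    have "of_int \<lfloor>r / (\<sigma> / 4)\<rfloor> \<le> r / (\<sigma> / 4)" "r / (\<sigma> / 4) \<le> of_int \<lfloor>r / (\<sigma> / 4)\<rfloor> + 1" by linarith+
    then have "\<sigma> / 4 * of_int \<lfloor>r / (\<sigma> / 4)\<rfloor> \<le> \<sigma> / 4 * (r / (\<sigma> / 4))"
      "\<sigma> / 4 * (r / (\<sigma> / 4)) \<le> \<sigma> / 4 * (of_int \<lfloor>r / (\<sigma> / 4)\<rfloor> + 1)"
      using \<sigma> by (intro mult_left_mono; simp)+
    then have "0 \<le> r - magnitude x" "r - magnitude x \<le> \<sigma> / 4"
      using \<sigma> unfolding m by (simp_all add: distrib_left)
    then have "(r - magnitude x)\<^sup>2 \<le> (\<sigma> / 4)\<^sup>2" by (intro power_mono)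
    moreover have "0 \<le> (x - \<mu>) ^ 4 / (64 * \<sigma>\<^sup>2)" by simp
    moreover have "(\<sigma> / 4)\<^sup>2 = \<sigma>\<^sup>2 / 16" by (simp add: power_divide)
    ultimately show ?thesis using sq by linarith
  next
    case False
    then have "magnitude x = 8 * \<sigma>" using \<sigma> by (simp add: magnitude_def r_def[symmetric] min_def)
    with False have "0 \<le> r - magnitude x" "r - magnitude x \<le> r" using \<sigma> by auto
    then have "(r - magnitude x)\<^sup>2 \<le> r\<^sup>2" by (intro power_mono)
    also have "r\<^sup>2 \<le> r ^ 4 / (64 * \<sigma>\<^sup>2)"
    proof -
      have "(8 * \<sigma>)\<^sup>2 \<le> r\<^sup>2" using False \<sigma> by (intro power_mono) auto
      then have "r\<^sup>2 * (8 * \<sigma>)\<^sup>2 \<le> r\<^sup>2 * r\<^sup>2" by (intro mult_left_mono) auto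
      also have "\<dots> = r ^ 4" by (simp add: power_add[symmetric])
      finally show ?thesis using \<sigma> by (simp add: pos_le_divide_eq power_mult_distrib)
    qed
    finally show ?thesis using sq zero_le_power2[of \<sigma>] unfolding r4 by linarith
  qed
qed

lemma mean_reconstruction_error:
  "integrable (source \<mu> \<sigma>) (\<lambda>x. (x - reconstruction x)\<^sup>2)"
  "(\<integral>x. (x - reconstruction x)\<^sup>2 \<partial>source \<mu> \<sigma>) \<le> \<sigma>\<^sup>2 / 8"
proof -
  interpret prob_space "source \<mu> \<sigma>" by (rule prob_space_source)
  note mom = normal_distribution_moments[OF \<sigma>, of \<mu>, folded source_def]
  let ?g = "\<lambda>x. \<sigma>\<^sup>2 / 16 + (x - \<mu>) ^ 4 / (64 * \<sigma>\<^sup>2)"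
  have g: "integrable (source \<mu> \<sigma>) ?g"
    using mom(4) by (intro Bochner_Integration.integrable_add integrable_const integrable_divide)
  show i: "integrable (source \<mu> \<sigma>) (\<lambda>x. (x - reconstruction x)\<^sup>2)"
  proof (rule Bochner_Integration.integrable_bound[OF g])
    show "AE x in source \<mu> \<sigma>. norm ((x - reconstruction x)\<^sup>2) \<le> norm (?g x)"
    proof (rule AE_I2)
      fix x show "norm ((x - reconstruction x)\<^sup>2) \<le> norm (?g x)"
        using reconstruction_error[of x] abs_ge_self[of "?g x"] by (simp only: real_norm_def abs_power2)
    qed
  qed measurable
  have "(\<integral>x. (x - reconstruction x)\<^sup>2 \<partial>source \<mu> \<sigma>) \<le> (\<integral>x. ?g x \<partial>source \<mu> \<sigma>)"
    by (rule integral_mono[OF i g reconstruction_error])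
  also have "\<dots> = \<sigma>\<^sup>2 / 16 + 3 * \<sigma> ^ 4 / (64 * \<sigma>\<^sup>2)"
    using mom(4,5) prob_space by (subst Bochner_Integration.integral_add) auto
  also have "\<dots> = \<sigma>\<^sup>2 * (7 / 64)" using \<sigma> by (simp add: field_simps power2_eq_square power4_eq_xxxx)
  also have "\<dots> \<le> \<sigma>\<^sup>2 * (1 / 8)" by (intro mult_left_mono) auto
  finally show "(\<integral>x. (x - reconstruction x)\<^sup>2 \<partial>source \<mu> \<sigma>) \<le> \<sigma>\<^sup>2 / 8" by simp
qed

text \<open>The fiber of \<open>magnitude\<close> is covered by two cells of
  \<open>reconstruction\<close>, one on each side of \<open>\<mu>\<close>. Reflection about
  \<open>\<mu>\<close> swaps them and preserves the source, so they have equal mass. The factor 2 is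
  what becomes the one bit of secret rate.\<close>

lemma measure_magnitude_le:
  "measure (source \<mu> \<sigma>) (magnitude -` {magnitude x} \<inter> space (source \<mu> \<sigma>)) \<le>
    2 * measure (source \<mu> \<sigma>)
      (magnitude -` {magnitude x} \<inter> (reconstruction -` {reconstruction x} \<inter> space (source \<mu> \<sigma>)))"
proof -
  let ?M = "source \<mu> \<sigma>"
  interpret prob_space ?M by (rule prob_space_source)
  define u where "u = magnitude x"
  define E where "E y = {x. magnitude x = u \<and> reconstruction x = y}" for y
  have E[measurable]: "E y \<in> sets borel" for y unfolding E_def by measurable
  have eqs: "magnitude -` {magnitude x} \<inter> space ?M = {x. magnitude x = u}"
    "magnitude -` {magnitude x} \<inter> (reconstruction -` {reconstruction x} \<inter> space ?M) = E (reconstruction x)"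
    by (auto simp: u_def E_def)
  have refl: "measure ?M (E (2 * \<mu> - y)) = measure ?M (E y)" for y
  proof -
    have "measure ?M (E y) = measure (distr ?M borel (\<lambda>x. 2 * \<mu> - x)) (E y)" by (simp add: source_reflect)
    also have "\<dots> = measure ?M ((\<lambda>x. 2 * \<mu> - x) -` E y \<inter> space ?M)" by (rule measure_distr) measurable
    also have "(\<lambda>x. 2 * \<mu> - x) -` E y \<inter> space ?M = E (2 * \<mu> - y)"
      by (auto simp: E_def magnitude_reflect reconstruction_reflect)
    finally show ?thesis by simp
  qed
  \<comment> \<open>Settles the case where the sign vanishes: \<open>\<mu>\<close> lies in the cell
    of magnitude zero, all of which is reconstructed as \<open>\<mu>\<close>.\<close>
  have "magnitude \<mu> = 0" using \<sigma> by (simp add: magnitude_def)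
  then have "{x. magnitude x = u} \<subseteq> E (reconstruction x) \<union> E (2 * \<mu> - reconstruction x)"
    by (auto simp: E_def u_def reconstruction_def sgn_real_def split: if_splits)
  then have "measure ?M {x. magnitude x = u} \<le> measure ?M (E (reconstruction x) \<union> E (2 * \<mu> - reconstruction x))"
    by (intro finite_measure_mono) auto
  also have "\<dots> \<le> measure ?M (E (reconstruction x)) + measure ?M (E (2 * \<mu> - reconstruction x))"
    by (intro measure_Un_le) auto
  finally show ?thesis unfolding eqs by (simp add: refl)
qed

lemma joint_law_sign_channel:
  "joint_law \<mu> \<sigma> sign_channel =
    distr (source \<mu> \<sigma>) (borel \<Otimes>\<^sub>M borel \<Otimes>\<^sub>M borel) (\<lambda>x. (x, reconstruction x, magnitude x))"
proof -
  let ?b = "borel :: real measure"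
  let ?N = "?b \<Otimes>\<^sub>M ?b \<Otimes>\<^sub>M ?b"
  have "joint_law \<mu> \<sigma> sign_channel = source \<mu> \<sigma> \<bind> (\<lambda>x. return ?N (x, reconstruction x, magnitude x))"
    unfolding joint_law_def sign_channel_def
  proof (rule bind_cong[OF refl])
    fix x
    have "(\<lambda>(y, u). (x, y, u)) \<in> ?b \<Otimes>\<^sub>M ?b \<rightarrow>\<^sub>M ?N" by measurable
    then show "distr (return (?b \<Otimes>\<^sub>M ?b) (reconstruction x, magnitude x)) ?N (\<lambda>(y, u). (x, y, u)) =
        return ?N (x, reconstruction x, magnitude x)"
      by (subst distr_return) (auto simp: space_pair_measure)
  qed
  also have "\<dots> = distr (source \<mu> \<sigma>) ?N (\<lambda>x. (x, reconstruction x, magnitude x))"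
    by (rule bind_return_distr') auto
  finally show ?thesis .
qed

lemma sign_channel_feasible: "\<exists>R\<ge>0. sign_channel \<in> feasible \<mu> \<sigma> R 1"
proof -
  let ?b = "borel :: real measure" and ?M = "source \<mu> \<sigma>"
  let ?V = "\<lambda>x. (magnitude x, reconstruction x)"
  have ch: "sign_channel \<in> channels"
    unfolding channels_def sign_channel_def[abs_def]
    by (rule measurable_compose[OF _ measurable_return_prob_space]) measurable
  have T: "(\<lambda>x. (x, reconstruction x, magnitude x)) \<in> ?M \<rightarrow>\<^sub>M ?b \<Otimes>\<^sub>M ?b \<Otimes>\<^sub>M ?b" by measurable
  have "cond_mutual_info (joint_law \<mu> \<sigma> sign_channel) Xv Yv Uv
      = cond_mutual_info ?M (\<lambda>x. x) reconstruction magnitude"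
    unfolding joint_law_sign_channel by (subst cond_mutual_info_distr[OF T]) auto
  also have "\<dots> \<le> ereal (log 2 2)"
    by (rule cond_mutual_info_finite_range_le[OF prob_space_source])
       (auto simp: finite_range_magnitude finite_range_reconstruction intro!: AE_I2 measure_magnitude_le[simplified])
  finally have 1: "cond_mutual_info (joint_law \<mu> \<sigma> sign_channel) Xv Yv Uv \<le> ereal 1" by simp
  have mi: "mutual_info (joint_law \<mu> \<sigma> sign_channel) borel (?b \<Otimes>\<^sub>M ?b) Xv (\<lambda>w. (Uv w, Yv w))
      = mutual_info ?M borel (?b \<Otimes>\<^sub>M ?b) (\<lambda>x. x) ?V"
    unfolding joint_law_sign_channel by (subst mutual_info_distr[OF T]) auto
  have "\<exists>R\<ge>0. mutual_info ?M borel (?b \<Otimes>\<^sub>M ?b) (\<lambda>x. x) ?V \<le> ereal R"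
  proof (rule mutual_info_finite_range_bounded[OF prob_space_source])
    show "finite (?V ` space ?M)"
      by (rule finite_subset[of _ "range magnitude \<times> range reconstruction"])
         (auto simp: finite_range_magnitude finite_range_reconstruction)
    fix v :: "real \<times> real"
    have "?V -` {v} \<inter> space ?M = {x. magnitude x = fst v \<and> reconstruction x = snd v}" by auto
    also have "\<dots> \<in> sets borel" by measurable
    finally show "?V -` {v} \<inter> space ?M \<in> sets ?M" by (simp add: sets_source)
  qed measurable
  then obtain R where "R \<ge> 0" "mutual_info ?M borel (?b \<Otimes>\<^sub>M ?b) (\<lambda>x. x) ?V \<le> ereal R" by blast
  then show ?thesis using ch 1 mi unfolding feasible_def by auto
qed

text \<open>Averaging over the reflection about \<open>\<mu>\<close> replaces a conditional mean. It
  keeps \<open>z (magnitude x)\<close> fixed, and for every number \<open>a\<close> the squares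
  \<open>(a - x)^2\<close> and \<open>(a - (2 * \<mu> - x))^2\<close> add up to at least
  \<open>2 * (x - \<mu>)^2\<close>. So no \<open>z\<close> has mean squared error below the
  variance.\<close>

lemma min_payoff_sign_channel_ge: "min_payoff \<mu> \<sigma> sign_channel \<ge> ereal (7 / 8)"
  unfolding min_payoff_def
proof (rule INF_greatest)
  fix z :: "real \<Rightarrow> real" assume z[measurable]: "z \<in> borel_measurable borel"
  let ?M = "source \<mu> \<sigma>" and ?b = "borel :: real measure"
  interpret prob_space ?M by (rule prob_space_source)
  define f where "f x = payoff \<sigma> x (reconstruction x) (z (magnitude x))" for x
  define e where "e x = (x - reconstruction x)\<^sup>2 / \<sigma>\<^sup>2" for x
  define q where "q x = (z (magnitude x) - x)\<^sup>2 / \<sigma>\<^sup>2" for x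
  have [measurable]: "f \<in> borel_measurable borel" "e \<in> borel_measurable borel" "q \<in> borel_measurable borel"
    unfolding f_def[abs_def] e_def[abs_def] q_def[abs_def] payoff_def by measurable
  have fq: "f x = q x - e x" for x
    by (simp add: f_def e_def q_def payoff_def diff_divide_distrib power2_commute)
  have e0: "e x \<ge> 0" and q0: "q x \<ge> 0" for x by (simp_all add: e_def q_def)
  have ei: "integrable ?M e" unfolding e_def[abs_def] using mean_reconstruction_error(1) by simp
  have e8: "(\<integral>x. e x \<partial>?M) \<le> 1 / 8"
    using mean_reconstruction_error(2) \<sigma> unfolding e_def by (simp add: divide_le_eq)
  have "ext_expectation (joint_law \<mu> \<sigma> sign_channel) (\<lambda>(x, y, u). payoff \<sigma> x y (z u)) = ext_expectation ?M f"
    unfolding joint_law_sign_channel f_def[abs_def]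
    by (subst ext_expectation_distr) (auto simp: payoff_def)
  also have "\<dots> \<ge> ereal (7 / 8)"
  \<comment> \<open>A wild \<open>z\<close> may have infinite mean squared error. The negative part
    of the payoff is always dominated by the integrable \<open>e\<close>, so the extended
    expectation is then infinite and the bound holds.\<close>
  proof (cases "(\<integral>\<^sup>+x. ennreal (f x) \<partial>?M) = \<infinity>")
    case True
    have "(\<integral>\<^sup>+x. ennreal (- f x) \<partial>?M) \<le> (\<integral>\<^sup>+x. ennreal (e x) \<partial>?M)"
      using q0 by (intro nn_integral_mono ennreal_leI) (simp add: fq)
    also have "\<dots> < \<infinity>" using ei e0 by (simp add: nn_integral_eq_integral)
    finally have "(\<integral>\<^sup>+x. ennreal (- f x) \<partial>?M) < \<infinity>" .
    then obtain r where "(\<integral>\<^sup>+x. ennreal (- f x) \<partial>?M) = ennreal r" "r \<ge> 0"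
      by (cases "(\<integral>\<^sup>+x. ennreal (- f x) \<partial>?M)") auto
    then show ?thesis using True by (simp add: ext_expectation_def enn2ereal_ennreal)
  next
    case False
    have "integrable ?M (\<lambda>x. max 0 (f x))"
    proof (rule integrableI_nonneg)
      have "(\<integral>\<^sup>+x. ennreal (max 0 (f x)) \<partial>?M) = (\<integral>\<^sup>+x. ennreal (f x) \<partial>?M)"
        by (intro nn_integral_cong) (simp add: max_def ennreal_neg)
      then show "(\<integral>\<^sup>+x. ennreal (max 0 (f x)) \<partial>?M) < \<infinity>" using False by (simp add: less_top)
    qed auto
    \<comment> \<open>Since \<open>q = f + e\<close>, a finite positive part of \<open>f\<close>
      already makes \<open>q\<close> integrable.\<close>
    then have "integrable ?M (\<lambda>x. max 0 (f x) + e x)" using ei by simp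
    then have qi: "integrable ?M q"
      by (rule Bochner_Integration.integrable_bound) (auto simp: fq q0 e0 max_def)
    have fi: "integrable ?M f" using qi ei by (simp add: fq[abs_def])
    note mom = normal_distribution_moments[OF \<sigma>, of \<mu>, folded source_def]
    have refl: "integrable ?M (\<lambda>x. q (2 * \<mu> - x))" "(\<integral>x. q (2 * \<mu> - x) \<partial>?M) = (\<integral>x. q x \<partial>?M)"
    proof -
      have d: "(\<lambda>x. 2 * \<mu> - x) \<in> ?M \<rightarrow>\<^sub>M borel" by measurable
      have "integrable (distr ?M borel (\<lambda>x. 2 * \<mu> - x)) q" using qi by (simp add: source_reflect)
      then show "integrable ?M (\<lambda>x. q (2 * \<mu> - x))" by (subst (asm) integrable_distr_eq[OF d]) auto
      have "(\<integral>x. q x \<partial>distr ?M borel (\<lambda>x. 2 * \<mu> - x)) = (\<integral>x. q (2 * \<mu> - x) \<partial>?M)"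
        by (rule integral_distr[OF d]) measurable
      then show "(\<integral>x. q (2 * \<mu> - x) \<partial>?M) = (\<integral>x. q x \<partial>?M)" by (simp add: source_reflect)
    qed
    have x2: "integrable ?M (\<lambda>x. (x - \<mu>)\<^sup>2)"
    proof -
      have "integrable ?M (\<lambda>x. x)"
        by (rule square_integrable_imp_integrable[OF _ mom(1)]) measurable
      then show ?thesis using mom(1)
        by (auto simp: power2_diff intro!: Bochner_Integration.integrable_diff Bochner_Integration.integrable_add)
    qed
    have "2 = (\<integral>x. 2 * (x - \<mu>)\<^sup>2 / \<sigma>\<^sup>2 \<partial>?M)"
      using mom(3) \<sigma> by simp
    also have "\<dots> \<le> (\<integral>x. q x + q (2 * \<mu> - x) \<partial>?M)"
    proof (rule integral_mono)
      fix x
      have "(z (magnitude x) - x)\<^sup>2 + (z (magnitude x) - (2 * \<mu> - x))\<^sup>2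
          = 2 * (z (magnitude x) - \<mu>)\<^sup>2 + 2 * (x - \<mu>)\<^sup>2"
        by (simp add: power2_eq_square algebra_simps)
      then have "2 * (x - \<mu>)\<^sup>2 \<le> (z (magnitude x) - x)\<^sup>2 + (z (magnitude x) - (2 * \<mu> - x))\<^sup>2" by simp
      then show "2 * (x - \<mu>)\<^sup>2 / \<sigma>\<^sup>2 \<le> q x + q (2 * \<mu> - x)"
        unfolding q_def magnitude_reflect add_divide_distrib[symmetric] by (intro divide_right_mono) auto
    qed (use x2 qi refl in auto)
    also have "\<dots> = 2 * (\<integral>x. q x \<partial>?M)" using qi refl by simp
    finally have "1 \<le> (\<integral>x. q x \<partial>?M)" by simp
    then have "7 / 8 \<le> (\<integral>x. f x \<partial>?M)" using e8 qi ei by (simp add: fq)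
    then show ?thesis by (simp add: ext_expectation_eq_integral[OF fi])
  qed
  finally show "ereal (7 / 8) \<le> ext_expectation (joint_law \<mu> \<sigma> sign_channel) (\<lambda>(x, y, u). payoff \<sigma> x y (z u))" .
qed

end

theorem mainTheorem4:
  fixes \<mu>\<^sub>0 \<sigma>\<^sub>0 :: real
  assumes "\<sigma>\<^sub>0 > 0"
  shows "\<exists>R Rs :: real. R \<ge> 0 \<and> Rs \<ge> 0 \<and>
    (SUP \<kappa> \<in> {\<kappa> \<in> feasible \<mu>\<^sub>0 \<sigma>\<^sub>0 R Rs. jointly_gaussian (joint_law \<mu>\<^sub>0 \<sigma>\<^sub>0 \<kappa>)}. min_payoff \<mu>\<^sub>0 \<sigma>\<^sub>0 \<kappa>)
      < (SUP \<kappa> \<in> feasible \<mu>\<^sub>0 \<sigma>\<^sub>0 R Rs. min_payoff \<mu>\<^sub>0 \<sigma>\<^sub>0 \<kappa>)"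
proof -
  obtain R where R: "R \<ge> 0" and feas: "sign_channel \<mu>\<^sub>0 \<sigma>\<^sub>0 \<in> feasible \<mu>\<^sub>0 \<sigma>\<^sub>0 R 1"
    using sign_channel_feasible[OF assms] by blast
  have "(SUP \<kappa> \<in> {\<kappa> \<in> feasible \<mu>\<^sub>0 \<sigma>\<^sub>0 R 1. jointly_gaussian (joint_law \<mu>\<^sub>0 \<sigma>\<^sub>0 \<kappa>)}. min_payoff \<mu>\<^sub>0 \<sigma>\<^sub>0 \<kappa>)
      \<le> ereal (3 / 4)"
    by (rule SUP_least) (use min_payoff_jointly_gaussian_le[OF assms] in auto)
  also have "\<dots> < ereal (7 / 8)" by simp
  also have "\<dots> \<le> min_payoff \<mu>\<^sub>0 \<sigma>\<^sub>0 (sign_channel \<mu>\<^sub>0 \<sigma>\<^sub>0)"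
    by (rule min_payoff_sign_channel_ge[OF assms])
  also have "\<dots> \<le> (SUP \<kappa> \<in> feasible \<mu>\<^sub>0 \<sigma>\<^sub>0 R 1. min_payoff \<mu>\<^sub>0 \<sigma>\<^sub>0 \<kappa>)"
    by (rule SUP_upper[OF feas])
  finally show ?thesis using R by (intro exI[of _ R] exI[of _ "1::real"]) auto
qed

end
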